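(* Let $q$ be a prime power, $m\ge1$, $1\le k\le q-1$ and $\mathcal C=\mathrm{PLift}_q(m,k)$. For each $1\le i\le m$ let $\omega_i$ be any primitive element of $\mathbb F_{q^i}$ and $\phi_i:\mathbb F_{q^i}\to\mathbb A^{m,i}(\mathbb F_q)$ any isomorphism. Then $$S=\{(0:\dots:0:1)\}\ \sqcup\ \bigsqcup_{i=1}^m\{\phi_i(\omega_i),\phi_i(\omega_i^2),\dots,\phi_i(\omega_i^{\dim\mathcal C_i})\}$$ is an information set for $\mathcal C$, where $\mathcal C_i=\mathrm{Lift}_q(i,k-1)$ for $1\le i\le m$.
   Context: Projective side. $\mathbb P^m=(\mathbb F_q^{m+1}\setminus\{0\})/\mathbb F_q^\times$; the standard representative of a point is the one whose leftmost non-zero coordinate is $1$. $\mathbb F_q[\mathbf X]^H_v$ is the space of homogeneous polynomials of degree $v$ in $X_0,\dots,X_m$ (together with $0$), and $\mathrm{ev}_{\mathbb P^m}(f)=(f(\mathbf P))_{\mathbf P\in\mathbb P^m}$, evaluating at standard representatives. $\mathrm{PRS}_q(k)=\{\mathrm{ev}_{\mathbb P^1}(g): g\in\mathbb F_q[S,T]^H_k\}$. $\mathrm{Emb}_{\mathbb P}(m)$ is the set of injective $\mathbb F_q$-linear maps $L:\mathbb F_q^2\to\mathbb F_q^{m+1}$, and $f\circ L=f(L(S,T))$. For $m\ge1$, $1\le k\le q-1$ and $v=k+(m-1)(q-1)$, $$\mathrm{PLift}_q(m,k)=\{\mathrm{ev}_{\mathbb P^m}(f): f\in\mathbb F_q[\mathbf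 X]^H_v,\ \forall L\in\mathrm{Emb}_{\mathbb P}(m),\ \mathrm{ev}_{\mathbb P^1}(f\circ L)\in\mathrm{PRS}_q(k)\}.$$ Affine side. For $f\in\mathbb F_q[X_1,\dots,X_m]$, $\mathrm{ev}_{\mathbb A^m}(f)=(f(\mathbf x))_{\mathbf x\in\mathbb F_q^m}$. $\mathrm{RS}_q(k)=\{\mathrm{ev}_{\mathbb A^1}(g): g\in\mathbb F_q[T],\deg g\le k\}$. $\mathrm{Emb}_{\mathbb A}(m)$ is the set of linear maps $L^*=(L_1,\dots,L_m):\mathbb F_q^2\to\mathbb F_q^m$ for which some $L_0$ makes $(L_0,\dots,L_m)$ an element of $\mathrm{Emb}_{\mathbb P}(m)$; $f\circ L^*$ is the univariate polynomial $f(L^*(1,T))$. For $m\ge1$, $0\le k\le q-2$, $$\mathrm{Lift}_q(m,k)=\{\mathrm{ev}_{\mathbb A^m}(f): f\in\mathbb F_q[X_1,\dots,X_m],\ \forall L\in\mathrm{Emb}_{\mathbb A}(m),\ \mathrm{ev}_{\mathbb A^1}(f\circ L)\in\mathrm{RS}_q(k)\}.$$ For $0\le i\le m$, $\mathbb A^{m,i}(\mathbb F_q)=\{(0:\dots:0:1:x_1:\dots:x_i): (x_1,\dots,x_i)\in\mathbb F_q^i\}\subseteq\mathbb P^m$, identified with $\mathbb F_q^i$; an isomorphism $\mathbb F_{q^i}\to\mathbb A^{m,i}(\mathbb F_q)$ is an $\mathbb F_q$-linear isomorphism $\mathbb F_{q^i}\to\mathbb F_q^i$ composed with this identification. A primitive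 element of a finite field is a generator of its multiplicative group. An information set of a linear code $\mathcal C\subseteq\mathbb F_q^X$ is a subset $S\subseteq X$ with $|S|=\dim\mathcal C$ such that the projection $\mathcal C\to\mathbb F_q^S$ is injective. *)

theory Defs
  imports
    Jordan_Normal_Form.VS_Connect
    "HOL-Library.Cardinality"
    "HOL-Library.Poly_Mapping"
    "HOL-Library.Function_Algebras"
    "HOL-Library.Disjoint_Sets"
    "HOL-Computational_Algebra.Polynomial"
    "HOL-Algebra.Multiplicative_Group"
    "HOL-Algebra.Generated_Groups"
begin

text \<open>Throughout, the field of \<open>q\<close> elements is a type \<open>'a :: {field, finite}\<close> with
  \<open>q = CARD('a)\<close>, and the space of vectors of length \<open>n\<close> is \<^term>\<open>carrier_vec n\<close>.\<close>

section \<open>Multivariate polynomials\<close>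

text \<open>Monomials are finitely supported exponent vectors. Variables are numbered from \<open>0\<close>, so
  \<open>X\<^sub>0, \<dots>, X\<^sub>m\<close> are the variables with index \<open>< m + 1\<close>, while the affine variables
  \<open>X\<^sub>1, \<dots>, X\<^sub>m\<close> are those with index \<open>0, \<dots>, m - 1\<close>, matching the coordinates of a vector.\<close>

type_synonym 'a mpoly = "(nat \<Rightarrow>\<^sub>0 nat) \<Rightarrow>\<^sub>0 'a"

definition mono_degree :: "(nat \<Rightarrow>\<^sub>0 nat) \<Rightarrow> nat" where
  "mono_degree t = (\<Sum>j\<in>Poly_Mapping.keys t. Poly_Mapping.lookup t j)"

definition polys :: "nat \<Rightarrow> 'a::zero mpoly set" where
  "polys n = {f. \<forall>t\<in>Poly_Mapping.keys f. Poly_Mapping.keys t \<subseteq> {..<n}}"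

definition hom_polys :: "nat \<Rightarrow> nat \<Rightarrow> 'a::zero mpoly set" where
  "hom_polys n v = {f \<in> polys n. \<forall>t\<in>Poly_Mapping.keys f. mono_degree t = v}"

text \<open>Substitution of the values \<open>x j\<close> for the variables, in a commutative semiring into which the
  coefficients are mapped by \<open>h\<close>. It yields both evaluation and composition.\<close>

definition subst_mpoly ::
    "('a::zero \<Rightarrow> 'b::comm_semiring_1) \<Rightarrow> (nat \<Rightarrow> 'b) \<Rightarrow> 'a mpoly \<Rightarrow> 'b" where
  "subst_mpoly h x f = (\<Sum>t\<in>Poly_Mapping.keys f. h (Poly_Mapping.lookup f t) * (\<Prod>j\<in>Poly_Mapping.keys t. x j ^ Poly_Mapping.lookup t j))"

definition eval_mpoly :: "'a::comm_semiring_1 mpoly \<Rightarrow> 'a vec \<Rightarrow> 'a" where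
  "eval_mpoly f x = subst_mpoly (\<lambda>c. c) (\<lambda>j. x $ j) f"


section \<open>Linear codes\<close>

text \<open>A codeword over an index set \<open>X\<close> is represented by a function on the whole type which is
  \<open>0\<close> outside \<open>X\<close>.\<close>

definition fun_scale :: "'a::field \<Rightarrow> ('x \<Rightarrow> 'a) \<Rightarrow> 'x \<Rightarrow> 'a" where
  "fun_scale c f = (\<lambda>x. c * f x)"

interpretation code: vector_space "fun_scale :: 'a::field \<Rightarrow> ('x \<Rightarrow> 'a) \<Rightarrow> 'x \<Rightarrow> 'a"
  by unfold_locales (auto simp: fun_scale_def algebra_simps)

definition information_set :: "'x set \<Rightarrow> ('x \<Rightarrow> 'a::field) set \<Rightarrow> 'x set \<Rightarrow> bool" where
  "information_set X C S \<longleftrightarrow>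
     S \<subseteq> X \<and> finite S \<and> card S = code.dim C \<and> inj_on (\<lambda>c. restrict c S) C"


section \<open>Projective codes\<close>

definition proj_rel :: "nat \<Rightarrow> ('a::field vec \<times> 'a vec) set" where
  "proj_rel m = {(u, v). u \<in> carrier_vec (m + 1) - {0\<^sub>v (m + 1)} \<and>
     v \<in> carrier_vec (m + 1) - {0\<^sub>v (m + 1)} \<and> (\<exists>c. c \<noteq> 0 \<and> v = c \<cdot>\<^sub>v u)}"

definition proj_space :: "nat \<Rightarrow> 'a::field vec set set" where
  "proj_space m = (carrier_vec (m + 1) - {0\<^sub>v (m + 1)}) // proj_rel m"

definition proj_pt :: "nat \<Rightarrow> 'a::field vec \<Rightarrow> 'a vec set" where
  "proj_pt m v = proj_rel m `` {v}"

definition std_rep :: "'a::field vec set \<Rightarrow> 'a vec" where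
  "std_rep P = (THE v. v \<in> P \<and> (\<exists>i<dim_vec v. v $ i = 1 \<and> (\<forall>j<i. v $ j = 0)))"

definition ev_proj :: "nat \<Rightarrow> 'a::field mpoly \<Rightarrow> 'a vec set \<Rightarrow> 'a" where
  "ev_proj m f = (\<lambda>P. if P \<in> proj_space m then eval_mpoly f (std_rep P) else 0)"

text \<open>A linear map from the plane to the space of dimension \<open>n\<close> is given by its \<open>n \<times> 2\<close> matrix.\<close>

definition emb_proj :: "nat \<Rightarrow> 'a::field mat set" where
  "emb_proj m = {L \<in> carrier_mat (m + 1) 2. inj_on (\<lambda>v. L *\<^sub>v v) (carrier_vec 2)}"

text \<open>\<open>f(L(S, T))\<close> as a polynomial in \<open>S\<close> (variable \<open>0\<close>) and \<open>T\<close> (variable \<open>1\<close>); row \<open>j\<close> of \<open>L\<close>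
  gives the linear form substituted for variable \<open>j\<close>.\<close>

definition comp_proj :: "'a::field mpoly \<Rightarrow> 'a mat \<Rightarrow> 'a mpoly" where
  "comp_proj f L = subst_mpoly (Poly_Mapping.single 0)
     (\<lambda>j. Poly_Mapping.single (Poly_Mapping.single 0 1) (L $$ (j, 0)) +
          Poly_Mapping.single (Poly_Mapping.single 1 1) (L $$ (j, 1))) f"

definition PRS :: "nat \<Rightarrow> ('a::field vec set \<Rightarrow> 'a) set" where
  "PRS k = ev_proj 1 ` hom_polys 2 k"

definition PLift :: "nat \<Rightarrow> nat \<Rightarrow> ('a::{field,finite} vec set \<Rightarrow> 'a) set" where
  "PLift m k = {ev_proj m f | f. f \<in> hom_polys (m + 1) (k + (m - 1) * (CARD('a) - 1)) \<and>
     (\<forall>L\<in>emb_proj m. ev_proj 1 (comp_proj f L) \<in> PRS k)}"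


section \<open>Affine codes\<close>

definition ev_aff :: "nat \<Rightarrow> 'a::field mpoly \<Rightarrow> 'a vec \<Rightarrow> 'a" where
  "ev_aff m f = (\<lambda>x. if x \<in> carrier_vec m then eval_mpoly f x else 0)"

text \<open>The affine line is the field itself and polynomials on it are of type \<^typ>\<open>'a poly\<close>.\<close>

definition RS :: "nat \<Rightarrow> ('a::field \<Rightarrow> 'a) set" where
  "RS k = {poly g | g. degree g \<le> k}"

text \<open>The matrices obtained from a projective embedding by deleting the row \<open>L\<^sub>0\<close>.\<close>

definition emb_aff :: "nat \<Rightarrow> 'a::field mat set" where
  "emb_aff m = {A \<in> carrier_mat m 2. \<exists>L\<in>emb_proj m. \<forall>i<m. row L (i + 1) = row A i}"

text \<open>\<open>f(L(1, T))\<close>\<close>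

definition comp_aff :: "'a::field mpoly \<Rightarrow> 'a mat \<Rightarrow> 'a poly" where
  "comp_aff f L = subst_mpoly (\<lambda>c. [:c:]) (\<lambda>j. [:L $$ (j, 0), L $$ (j, 1):]) f"

definition Lift :: "nat \<Rightarrow> nat \<Rightarrow> ('a::field vec \<Rightarrow> 'a) set" where
  "Lift m k = {ev_aff m f | f. f \<in> polys m \<and> (\<forall>L\<in>emb_aff m. poly (comp_aff f L) \<in> RS k)}"


section \<open>Affine cells and extension fields\<close>

text \<open>The point \<open>(0 : \<dots> : 0 : 1 : x\<^sub>1 : \<dots> : x\<^sub>i)\<close>, for \<open>i \<le> m\<close>.\<close>

definition cell_pt :: "nat \<Rightarrow> nat \<Rightarrow> 'a::field vec \<Rightarrow> 'a vec set" where
  "cell_pt m i x = proj_pt m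
     (vec (m + 1) (\<lambda>j. if j < m - i then 0 else if j = m - i then 1 else x $ (j - (m - i) - 1)))"

definition primitive_element :: "('b, 'r) ring_scheme \<Rightarrow> 'b \<Rightarrow> bool" where
  "primitive_element K w \<longleftrightarrow>
     w \<in> carrier (mult_of K) \<and> generate (mult_of K) {w} = carrier (mult_of K)"

text \<open>\<open>K\<close> is a field of \<open>q\<^sup>i\<close> elements containing the base field via \<open>e\<close>.\<close>

definition ext_field :: "nat \<Rightarrow> ('b, 'r) ring_scheme \<Rightarrow> ('a::{field,finite} \<Rightarrow> 'b) \<Rightarrow> bool" where
  "ext_field i K e \<longleftrightarrow>
     field K \<and> card (carrier K) = CARD('a) ^ i \<and> e \<in> Ring.ring_hom class_ring K"

definition linear_iso ::
    "nat \<Rightarrow> ('b, 'r) ring_scheme \<Rightarrow> ('a::field \<Rightarrow> 'b) \<Rightarrow> ('b \<Rightarrow> 'a vec) \<Rightarrow> bool" where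
  "linear_iso i K e \<psi> \<longleftrightarrow> bij_betw \<psi> (carrier K) (carrier_vec i) \<and>
     (\<forall>x\<in>carrier K. \<forall>y\<in>carrier K. \<psi> (x \<oplus>\<^bsub>K\<^esub> y) = \<psi> x + \<psi> y) \<and>
     (\<forall>c. \<forall>x\<in>carrier K. \<psi> (e c \<otimes>\<^bsub>K\<^esub> x) = c \<cdot>\<^sub>v \<psi> x)"

definition cell_iso ::
    "nat \<Rightarrow> nat \<Rightarrow> ('b, 'r) ring_scheme \<Rightarrow> ('a::field \<Rightarrow> 'b) \<Rightarrow> ('b \<Rightarrow> 'a vec set) \<Rightarrow> bool" where
  "cell_iso m i K e \<phi> \<longleftrightarrow>
     (\<exists>\<psi>. linear_iso i K e \<psi> \<and> (\<forall>x\<in>carrier K. \<phi> x = cell_pt m i (\<psi> x)))"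

end

theory Submission
  imports Defs
begin

text \<open>A codeword of \<open>PLift\<close> is the same as a function \<open>g\<close> on the space of dimension \<open>m + 1\<close> whose
  restriction to every plane is a binary form of degree \<open>k\<close>: when \<open>g\<close> is expressed by a reduced
  polynomial, homogeneity under scaling puts all degrees in one class modulo \<open>q - 1\<close>, the only degree
  that is too large is excluded by summing over the planes through a fixed vector, and smaller degrees
  are raised by adding a multiple of \<open>q - 1\<close> to an exponent. Likewise \<open>Lift\<close> consists of the functions
  that are of low degree on every line.

  If \<open>g\<close> vanishes on all cells of dimension less than \<open>i\<close>, then the restriction of \<open>g\<close> to the cell of
  dimension \<open>i\<close> lies in \<open>Lift i (k - 1)\<close>; conversely every \<open>h\<close> in that code extends to
  \<open>(x, y) \<mapsto> x\<^sup>k h(y / x)\<close>, which vanishes on the smaller cells. So information sets of the affine codes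
  may be glued. The code \<open>Lift i (k - 1)\<close> is invariant under multiplication by a primitive element of
  the extension field, and a codeword is determined by its nonzero positions, so that it is
  essentially a cyclic code, for which any \<open>dim\<close> consecutive positions form an information set.\<close>

section \<open>Power sums and interpolation over a finite field\<close>

text \<open>Let q be the field size. A reduced polynomial in m + 1 variables has degree at most (m +
  1)(q - 1), so among the positive degrees congruent to k modulo q - 1 only k + m(q - 1) exceeds the
  prescribed k + (m - 1)(q - 1). Its coefficient is, up to sign, the sum over the whole space of g
  times a monomial of degree q - 1 - k; on each plane this product is a binary form of degree q - 1,
  and the values of such a form sum to 0. No dimension is computed. A code of dimension d has q^d
  words, so the projective dimension is read off from a bijection between codewords and all
  functions on S, and in the affine codes counting turns injectivity of a restriction into
  surjectivity. The drop from k to k - 1 comes from infinity: along a line in a cell, the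
  coefficient of t^k is the value of g at the direction vector, which lies over smaller cells. The
  bound k - 1 < q - 1 makes the value at the origin, the one point that is not a power of the
  primitive element, depend on the others.\<close>

lemma finite_field_card_gt_1: "CARD('a::{field,finite}) > 1"
proof -
  have "card {0::'a, 1} \<le> CARD('a)" by (intro card_mono) auto
  then show ?thesis by simp
qed

text \<open>Multiplication by c permutes the nonzero elements, so their product is multiplied by
  c^(q - 1) and yet unchanged.\<close>

lemma finite_field_power_card_minus_1:
  fixes c :: "'a::{field,finite}"
  assumes "c \<noteq> 0"
  shows "c ^ (CARD('a) - 1) = 1"
proof -
  have bij: "bij_betw (\<lambda>x. c * x) (- {0}) (- {0 :: 'a})"
    using assms by (intro bij_betwI[where g = "\<lambda>x. x / c"]) auto
  have "(\<Prod>x\<in>- {0 :: 'a}. x) = (\<Prod>x\<in>- {0 :: 'a}. c * x)"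
    using prod.reindex_bij_betw[OF bij, of "\<lambda>x. x"] by simp
  also have "\<dots> = c ^ card (- {0 :: 'a}) * (\<Prod>x\<in>- {0 :: 'a}. x)"
    by (simp add: prod.distrib)
  finally have "c ^ card (- {0 :: 'a}) = 1" by simp
  then show ?thesis by (simp add: Compl_eq_Diff_UNIV card_Diff_singleton)
qed

text \<open>Otherwise X^r - 1 would have q - 1 > r roots.\<close>

lemma finite_field_nonzero_power_ne_1:
  assumes "0 < r" "r < CARD('a::{field,finite}) - 1"
  shows "\<exists>c::'a. c \<noteq> 0 \<and> c ^ r \<noteq> 1"
proof (rule ccontr)
  assume neg: "\<not> ?thesis"
  define p :: "'a poly" where "p = Polynomial.monom 1 r - 1"
  have "Polynomial.coeff p r = 1" using assms by (simp add: p_def)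
  then have "p \<noteq> 0" by auto
  have "Polynomial.degree p \<le> r" unfolding p_def by (intro degree_diff_le) (auto simp: degree_monom_le)
  have "CARD('a) - 1 = card (- {0::'a})" by (simp add: Compl_eq_Diff_UNIV card_Diff_singleton)
  also have "\<dots> \<le> card {x. poly p x = 0}"
    using neg by (intro card_mono) (auto simp: p_def poly_monom)
  also have "\<dots> \<le> Polynomial.degree p" using \<open>p \<noteq> 0\<close> by (rule card_poly_roots_bound)
  finally show False using \<open>Polynomial.degree p \<le> r\<close> assms by simp
qed

lemma finite_field_power_mod:
  fixes c :: "'a::{field,finite}"
  assumes "c \<noteq> 0"
  shows "c ^ (A mod (CARD('a) - 1)) = c ^ A"
proof -
  have "c ^ A = c ^ ((CARD('a) - 1) * (A div (CARD('a) - 1)) + A mod (CARD('a) - 1))" by simp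
  also have "\<dots> = c ^ (A mod (CARD('a) - 1))"
    using finite_field_power_card_minus_1[OF assms]
    by (simp only: power_add power_mult power_one mult_1_left)
  finally show ?thesis by simp
qed

lemma finite_field_power_eq_imp_mod_eq:
  assumes eq: "\<And>c::'a::{field,finite}. c \<noteq> 0 \<Longrightarrow> c ^ A = c ^ B"
  shows "A mod (CARD('a) - 1) = B mod (CARD('a) - 1)"
proof (rule ccontr)
  define N where "N = CARD('a) - 1"
  have N: "N > 0" using finite_field_card_gt_1[where 'a = 'a] by (simp add: N_def)
  have no: False if "a < b" "b < N" "\<And>c::'a. c \<noteq> 0 \<Longrightarrow> c ^ a = c ^ b" for a b
  proof -
    have "0 < b - a" "b - a < CARD('a) - 1" using that by (auto simp: N_def)
    then obtain c :: 'a where c: "c \<noteq> 0" "c ^ (b - a) \<noteq> 1"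
      using finite_field_nonzero_power_ne_1 by blast
    have "c ^ b = c ^ a * c ^ (b - a)" using \<open>a < b\<close> by (simp flip: power_add)
    then show False using c that(3)[of c] by simp
  qed
  have eq': "c ^ (A mod N) = c ^ (B mod N)" if "c \<noteq> 0" for c :: 'a
    unfolding N_def using eq[OF that] by (simp only: finite_field_power_mod[OF that])
  assume "A mod (CARD('a) - 1) \<noteq> B mod (CARD('a) - 1)"
  then consider "A mod N < B mod N" | "B mod N < A mod N"
    unfolding N_def by linarith
  then show False
  proof cases
    case 1
    then show ?thesis using no[of "A mod N" "B mod N"] eq' N by simp
  next
    case 2
    then show ?thesis using no[of "B mod N" "A mod N"] eq' N by simp
  qed
qed

text \<open>Positivity of A and B makes both sides 0 at c = 0. Hence a positive exponent may grow by
  a multiple of q - 1 without changing the function.\<close>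

lemma finite_field_power_mod_eq:
  fixes c :: "'a::{field,finite}"
  assumes "A mod (CARD('a) - 1) = B mod (CARD('a) - 1)" "A > 0" "B > 0"
  shows "c ^ A = c ^ B"
proof (cases "c = 0")
  case True
  then show ?thesis using assms(2,3) by (simp add: power_0_left)
next
  case False
  then show ?thesis using assms(1) finite_field_power_mod by metis
qed

text \<open>Translation by 1 permutes the field and adds q to the sum of all elements.\<close>

lemma of_nat_CARD_eq_0: "(of_nat CARD('a) :: 'a::{field,finite}) = 0"
proof -
  have "(\<Sum>x\<in>UNIV. x) = (\<Sum>x\<in>UNIV. x + 1 :: 'a)"
    by (rule sum.reindex_bij_betw[symmetric])
       (intro bij_betwI[where g = "\<lambda>x. x - 1"]; auto)
  then show ?thesis by (simp add: sum.distrib)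
qed

text \<open>Scaling the summation variable by c multiplies the sum by c^i, and some c has c^i
  different from 1. For i = 0 the sum is q.\<close>

lemma finite_field_power_sum:
  assumes "i < CARD('a::{field,finite}) - 1"
  shows "(\<Sum>x\<in>UNIV. x ^ i) = (0 :: 'a)"
proof (cases "i = 0")
  case True
  then show ?thesis by (simp add: of_nat_CARD_eq_0)
next
  case False
  then obtain c :: 'a where c: "c \<noteq> 0" "c ^ i \<noteq> 1"
    using finite_field_nonzero_power_ne_1 assms by blast
  have bij: "bij_betw (\<lambda>x. c * x) UNIV (UNIV :: 'a set)"
    using c by (intro bij_betwI[where g = "\<lambda>x. x / c"]) auto
  have "(\<Sum>x\<in>UNIV. x ^ i) = (\<Sum>x\<in>UNIV. (c * x) ^ i :: 'a)"
    using sum.reindex_bij_betw[OF bij, of "\<lambda>x. x ^ i"] by simp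
  also have "\<dots> = c ^ i * (\<Sum>x\<in>UNIV. x ^ i)"
    by (simp add: power_mult_distrib sum_distrib_left)
  finally have "(c ^ i - 1) * (\<Sum>x\<in>UNIV. x ^ i) = 0" by (simp add: algebra_simps)
  then show ?thesis using c by simp
qed

text \<open>The coefficients in \<open>x\<close> of \<open>1 - (x - y) ^ (q - 1)\<close>, where
  \<open>(x - y) ^ (q - 1) = (\<Sum>a<q. y ^ (q - 1 - a) * x ^ a)\<close> over the field of \<open>q\<close> elements.\<close>

definition delta_coeff :: "nat \<Rightarrow> 'a::{field,finite} \<Rightarrow> 'a" where
  "delta_coeff a y = (if a = 0 then 1 - y ^ (CARD('a) - 1) else - (y ^ (CARD('a) - 1 - a)))"

text \<open>\<open>T\<close> is the quotient (x^q - y^q) / (x - y), which is 1 for distinct x and y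
  because z^q = z; for x = y it is q * y^(q - 1) = 0. The extra 1 in the coefficient of index 0
  turns this into \<open>1 - T\<close>.\<close>

lemma sum_delta_coeff:
  fixes x y :: "'a::{field,finite}"
  shows "(\<Sum>a<CARD('a). delta_coeff a y * x ^ a) = (if x = y then 1 else 0)"
proof -
  define N where "N = CARD('a) - 1"
  have N: "CARD('a) = Suc N" "N > 0"
    using finite_field_card_gt_1[where 'a = 'a] by (auto simp: N_def)
  have frob: "z ^ Suc N = z" for z :: 'a
    using finite_field_power_card_minus_1[of z] by (cases "z = 0") (simp_all add: N(1))
  define T where "T = (\<Sum>a<Suc N. y ^ (N - a) * x ^ a)"
  have "(\<Sum>a<CARD('a). delta_coeff a y * x ^ a)
      = (\<Sum>a<Suc N. (if a = 0 then 1 else 0) - y ^ (N - a) * x ^ a)"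
    unfolding N(1) by (intro sum.cong) (auto simp: delta_coeff_def N_def)
  also have "\<dots> = 1 - T" by (simp add: sum_subtractf T_def del: sum.lessThan_Suc)
  finally have eq: "(\<Sum>a<CARD('a). delta_coeff a y * x ^ a) = 1 - T" .
  have "T = (if x = y then 0 else 1)"
  proof (cases "x = y")
    case True
    have "T = (\<Sum>a<Suc N. y ^ N)"
      unfolding T_def True by (intro sum.cong) (auto simp flip: power_add)
    also have "\<dots> = of_nat CARD('a) * y ^ N" by (simp add: N(1))
    finally show ?thesis using True by (simp add: of_nat_CARD_eq_0)
  next
    case False
    have "x ^ Suc N - y ^ Suc N = (x - y) * T"
      unfolding T_def diff_power_eq_sum by (simp add: mult.commute)
    then have "x - y = (x - y) * T" by (simp only: frob)
    then show ?thesis using False by simp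
  qed
  then show ?thesis using eq by simp
qed

text \<open>As a function of y the coefficient is homogeneous of degree -a, because its exponent is
  q - 1 - a and c^(q - 1) = 1.\<close>

lemma delta_coeff_scale:
  fixes c y :: "'a::{field,finite}"
  assumes "c \<noteq> 0" "a < CARD('a)"
  shows "delta_coeff a (c * y) * c ^ a = delta_coeff a y"
proof (cases "a = 0")
  case True
  then show ?thesis using assms finite_field_power_card_minus_1[of c]
    by (simp add: delta_coeff_def power_mult_distrib)
next
  case False
  have "c ^ (CARD('a) - 1 - a) * c ^ a = 1"
    using assms finite_field_power_card_minus_1[of c] by (simp flip: power_add)
  then show ?thesis using False
    by (simp add: delta_coeff_def power_mult_distrib mult.commute mult.left_commute)
qed

section \<open>Interpolation by reduced polynomials in several variables\<close>

lemma finite_carrier_vec: "finite (carrier_vec n :: 'b::finite vec set)"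
proof -
  have bij: "bij_betw (\<lambda>v. restrict (vec_index v) {..<n}) (carrier_vec n) ({..<n} \<rightarrow>\<^sub>E (UNIV :: 'b set))"
    by (intro bij_betwI[where g = "vec n"]) (auto simp: fun_eq_iff PiE_def extensional_def)
  show ?thesis using bij_betw_finite[OF bij] by (simp add: finite_PiE)
qed

text \<open>Extensional functions make this set finite and match the expansion of a product of sums;
  the type token supplies q.\<close>

definition exponents :: "nat \<Rightarrow> 'a itself \<Rightarrow> (nat \<Rightarrow> nat) set" where
  "exponents n _ = {..<n} \<rightarrow>\<^sub>E {..<CARD('a)}"

text \<open>The coefficient at the exponents a of the sum over y of g(y) times the indicator
  polynomial of y, which is a product of one-variable indicators.\<close>

definition interp_coeff :: "nat \<Rightarrow> ('a::{field,finite} vec \<Rightarrow> 'a) \<Rightarrow> (nat \<Rightarrow> nat) \<Rightarrow> 'a" where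
  "interp_coeff n g a = (\<Sum>y\<in>carrier_vec n. g y * (\<Prod>j<n. delta_coeff (a j) (y $ j)))"

lemma finite_exponents: "finite (exponents n TYPE('a))"
  by (simp add: exponents_def finite_PiE)

lemma interpolation:
  fixes g :: "'a::{field,finite} vec \<Rightarrow> 'a"
  assumes x: "x \<in> carrier_vec n"
  shows "g x = (\<Sum>a\<in>exponents n TYPE('a). interp_coeff n g a * (\<Prod>j<n. (x $ j) ^ a j))"
proof -
  have delta: "(\<Sum>a\<in>exponents n TYPE('a). \<Prod>j<n. delta_coeff (a j) (y $ j) * (x $ j) ^ a j)
      = (if y = x then 1 else 0)" if y: "y \<in> carrier_vec n" for y
  proof -
    have "(\<Sum>a\<in>exponents n TYPE('a). \<Prod>j<n. delta_coeff (a j) (y $ j) * (x $ j) ^ a j)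
       = (\<Prod>j<n. \<Sum>a<CARD('a). delta_coeff a (y $ j) * (x $ j) ^ a)"
      unfolding exponents_def by (subst prod_sum_PiE) auto
    also have "\<dots> = (\<Prod>j<n. if x $ j = y $ j then 1 else 0)"
      by (simp add: sum_delta_coeff)
    also have "\<dots> = (if y = x then 1 else 0)"
      using x y by (auto simp: prod_zero_iff intro!: eq_vecI)
    finally show ?thesis .
  qed
  have "(\<Sum>a\<in>exponents n TYPE('a). interp_coeff n g a * (\<Prod>j<n. (x $ j) ^ a j))
      = (\<Sum>a\<in>exponents n TYPE('a). \<Sum>y\<in>carrier_vec n.
           g y * (\<Prod>j<n. delta_coeff (a j) (y $ j) * (x $ j) ^ a j))"
    by (simp add: interp_coeff_def sum_distrib_right prod.distrib mult.assoc)
  also have "\<dots> = (\<Sum>y\<in>carrier_vec n. g y *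
      (\<Sum>a\<in>exponents n TYPE('a). \<Prod>j<n. delta_coeff (a j) (y $ j) * (x $ j) ^ a j))"
    by (subst sum.swap) (simp add: sum_distrib_left)
  also have "\<dots> = (\<Sum>y\<in>carrier_vec n. if y = x then g y else 0)"
    by (intro sum.cong refl, subst delta) auto
  also have "\<dots> = g x" using x by (simp add: finite_carrier_vec)
  finally show ?thesis by simp
qed

section \<open>Evaluation of polynomials\<close>

definition mono_val :: "(nat \<Rightarrow> 'b::comm_semiring_1) \<Rightarrow> (nat \<Rightarrow>\<^sub>0 nat) \<Rightarrow> 'b" where
  "mono_val x t = (\<Prod>j\<in>Poly_Mapping.keys t. x j ^ Poly_Mapping.lookup t j)"

text \<open>Exponents outside the keys are 0 and contribute factors 1, so several monomials can be
  compared over one common index set.\<close>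

lemma mono_val_superset:
  assumes "finite J" "Poly_Mapping.keys t \<subseteq> J"
  shows "mono_val x t = (\<Prod>j\<in>J. x j ^ Poly_Mapping.lookup t j)"
  unfolding mono_val_def using assms
  by (intro prod.mono_neutral_left) (auto simp: in_keys_iff)

lemma mono_val_add: "mono_val x (s + t) = mono_val x s * mono_val x t"
proof -
  define J where "J = Poly_Mapping.keys s \<union> Poly_Mapping.keys t"
  have "finite J" "Poly_Mapping.keys s \<subseteq> J" "Poly_Mapping.keys t \<subseteq> J"
    "Poly_Mapping.keys (s + t) \<subseteq> J"
    by (auto simp: J_def dest: subsetD[OF keys_add])
  then show ?thesis
    by (simp add: mono_val_superset[of J] lookup_add power_add prod.distrib)
qed

lemma mono_val_zero [simp]: "mono_val x 0 = 1"
  by (simp add: mono_val_def)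

lemma mono_degree_superset:
  assumes "finite J" "Poly_Mapping.keys t \<subseteq> J"
  shows "mono_degree t = (\<Sum>j\<in>J. Poly_Mapping.lookup t j)"
  unfolding mono_degree_def using assms
  by (intro sum.mono_neutral_left) (auto simp: in_keys_iff)

lemma eval_mpoly_superset:
  assumes "finite T" "Poly_Mapping.keys f \<subseteq> T"
  shows "eval_mpoly f x = (\<Sum>t\<in>T. Poly_Mapping.lookup f t * mono_val (vec_index x) t)"
  unfolding eval_mpoly_def subst_mpoly_def mono_val_def[symmetric] using assms
  by (intro sum.mono_neutral_left) (auto simp: in_keys_iff)

lemma eval_mpoly_add: "eval_mpoly (f + g) x = eval_mpoly f x + eval_mpoly g x"
proof -
  define T where "T = Poly_Mapping.keys f \<union> Poly_Mapping.keys g"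
  have "finite T" "Poly_Mapping.keys f \<subseteq> T" "Poly_Mapping.keys g \<subseteq> T"
    "Poly_Mapping.keys (f + g) \<subseteq> T"
    by (auto simp: T_def dest: subsetD[OF keys_add])
  then show ?thesis
    by (simp add: eval_mpoly_superset[of T] lookup_add algebra_simps sum.distrib)
qed

lemma eval_mpoly_zero [simp]: "eval_mpoly 0 x = 0"
  by (simp add: eval_mpoly_superset[of "{}"])

lemma eval_mpoly_single [simp]:
  "eval_mpoly (Poly_Mapping.single t c) x = c * mono_val (vec_index x) t"
  by (subst eval_mpoly_superset[of "{t}"]) auto

lemma eval_mpoly_sum: "eval_mpoly (\<Sum>i\<in>I. f i) x = (\<Sum>i\<in>I. eval_mpoly (f i) x)"
  by (induction I rule: infinite_finite_induct) (auto simp: eval_mpoly_add)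

lemma poly_mapping_sum_single:
  "(\<Sum>t\<in>Poly_Mapping.keys f. Poly_Mapping.single t (Poly_Mapping.lookup f t)) = f"
  by (rule poly_mapping_eqI) (auto simp: lookup_sum lookup_single when_def in_keys_iff)

lemma eval_mpoly_mult: "eval_mpoly (f * g) x = eval_mpoly f x * eval_mpoly g x"
proof -
  have "f * g = (\<Sum>s\<in>Poly_Mapping.keys f. \<Sum>t\<in>Poly_Mapping.keys g.
      Poly_Mapping.single (s + t) (Poly_Mapping.lookup f s * Poly_Mapping.lookup g t))"
    by (subst poly_mapping_sum_single[of f, symmetric], subst poly_mapping_sum_single[of g, symmetric])
       (simp only: sum_product mult_single)
  then have "eval_mpoly (f * g) x = (\<Sum>s\<in>Poly_Mapping.keys f. \<Sum>t\<in>Poly_Mapping.keys g.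
      (Poly_Mapping.lookup f s * mono_val (vec_index x) s) *
      (Poly_Mapping.lookup g t * mono_val (vec_index x) t))"
    by (simp add: eval_mpoly_sum mono_val_add algebra_simps)
  also have "\<dots> = eval_mpoly f x * eval_mpoly g x"
    by (simp add: sum_product eval_mpoly_superset[of "Poly_Mapping.keys f"]
        eval_mpoly_superset[of "Poly_Mapping.keys g"])
  finally show ?thesis .
qed

lemma eval_mpoly_one [simp]: "eval_mpoly 1 x = 1"
  by (simp flip: single_one)

lemma eval_mpoly_power: "eval_mpoly (f ^ n) x = eval_mpoly f x ^ n"
  by (induction n) (auto simp: eval_mpoly_mult)

lemma eval_mpoly_prod: "eval_mpoly (\<Prod>i\<in>I. f i) x = (\<Prod>i\<in>I. eval_mpoly (f i) x)"
  by (induction I rule: infinite_finite_induct) (auto simp: eval_mpoly_mult)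

lemma index_mult_mat_vec_2:
  fixes L :: "'a::comm_semiring_1 mat"
  assumes "L \<in> carrier_mat n 2" "x \<in> carrier_vec 2" "j < n"
  shows "(L *\<^sub>v x) $ j = L $$ (j, 0) * x $ 0 + L $$ (j, 1) * x $ 1"
  using assms by (auto simp: scalar_prod_def numeral_2_eq_2)

text \<open>Evaluation respects sums and products, so it passes into the substituted linear forms.
  The bound on the variables of f keeps every index within the rows of L.\<close>

lemma eval_comp_proj:
  assumes f: "f \<in> polys (m + 1)" and L: "L \<in> carrier_mat (m + 1) 2" and x: "x \<in> carrier_vec 2"
  shows "eval_mpoly (comp_proj f L) x = eval_mpoly f (L *\<^sub>v x)"
proof -
  note row = index_mult_mat_vec_2[OF L x]
  have var: "mono_val (vec_index x) (Poly_Mapping.single i 1) = x $ i" for i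
    by (simp add: mono_val_superset[of "{i}"])
  have "eval_mpoly (comp_proj f L) x = (\<Sum>t\<in>Poly_Mapping.keys f. Poly_Mapping.lookup f t *
     (\<Prod>j\<in>Poly_Mapping.keys t. (L $$ (j, 0) * x $ 0 + L $$ (j, 1) * x $ 1) ^ Poly_Mapping.lookup t j))"
    unfolding comp_proj_def subst_mpoly_def
    by (simp only: eval_mpoly_sum eval_mpoly_mult eval_mpoly_prod eval_mpoly_power eval_mpoly_add
          eval_mpoly_single var mono_val_zero mult_1_right)
  also have "\<dots> = (\<Sum>t\<in>Poly_Mapping.keys f. Poly_Mapping.lookup f t *
     (\<Prod>j\<in>Poly_Mapping.keys t. ((L *\<^sub>v x) $ j) ^ Poly_Mapping.lookup t j))"
    using f by (intro sum.cong prod.cong refl arg_cong2[where f = "(*)"] arg_cong2[where f = "(^)"])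
       (subst row, auto simp: polys_def)
  finally show ?thesis by (simp add: eval_mpoly_def subst_mpoly_def)
qed

lemma poly_comp_aff:
  assumes f: "f \<in> polys m" and L: "L \<in> carrier_mat m 2"
  shows "poly (comp_aff f L) t = eval_mpoly f (col L 0 + t \<cdot>\<^sub>v col L 1)"
proof -
  have col: "(col L 0 + t \<cdot>\<^sub>v col L 1) $ j = L $$ (j, 0) + t * L $$ (j, 1)" if "j < m" for j
    using that L by simp
  have "poly (comp_aff f L) t = (\<Sum>s\<in>Poly_Mapping.keys f. Poly_Mapping.lookup f s *
     (\<Prod>j\<in>Poly_Mapping.keys s. (L $$ (j, 0) + t * L $$ (j, 1)) ^ Poly_Mapping.lookup s j))"
    by (simp add: comp_aff_def subst_mpoly_def poly_sum poly_prod)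
  also have "\<dots> = (\<Sum>s\<in>Poly_Mapping.keys f. Poly_Mapping.lookup f s *
     (\<Prod>j\<in>Poly_Mapping.keys s. ((col L 0 + t \<cdot>\<^sub>v col L 1) $ j) ^ Poly_Mapping.lookup s j))"
    using f by (intro sum.cong prod.cong refl arg_cong2[where f = "(*)"] arg_cong2[where f = "(^)"])
       (subst col, auto simp: polys_def)
  finally show ?thesis by (simp add: eval_mpoly_def subst_mpoly_def)
qed

section \<open>Monomials with prescribed exponents, and homogeneity\<close>

definition mono_of :: "nat \<Rightarrow> (nat \<Rightarrow> nat) \<Rightarrow> nat \<Rightarrow>\<^sub>0 nat" where
  "mono_of n a = (\<Sum>j<n. Poly_Mapping.single j (a j))"

lemma lookup_mono_of: "Poly_Mapping.lookup (mono_of n a) j = (if j < n then a j else 0)"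
  by (auto simp: mono_of_def lookup_sum lookup_single when_def)

lemma keys_mono_of: "Poly_Mapping.keys (mono_of n a) \<subseteq> {..<n}"
  by (auto simp: in_keys_iff lookup_mono_of split: if_splits)

lemma mono_val_mono_of: "mono_val x (mono_of n a) = (\<Prod>j<n. x j ^ a j)"
  by (simp add: mono_val_superset[OF _ keys_mono_of] lookup_mono_of)

lemma mono_degree_mono_of: "mono_degree (mono_of n a) = (\<Sum>j<n. a j)"
  by (simp add: mono_degree_superset[OF _ keys_mono_of] lookup_mono_of)

lemma polys_add: "f \<in> polys n \<Longrightarrow> g \<in> polys n \<Longrightarrow> f + g \<in> polys n"
  using keys_add[of f g] unfolding polys_def by blast

lemma hom_polys_add: "f \<in> hom_polys n v \<Longrightarrow> g \<in> hom_polys n v \<Longrightarrow> f + g \<in> hom_polys n v"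
  using keys_add[of f g] polys_add[of f n g] unfolding hom_polys_def by blast

lemma polys_sum: "(\<And>i. i \<in> I \<Longrightarrow> f i \<in> polys n) \<Longrightarrow> (\<Sum>i\<in>I. f i) \<in> polys n"
  by (induction I rule: infinite_finite_induct) (simp_all add: polys_add, simp_all add: polys_def)

lemma hom_polys_sum: "(\<And>i. i \<in> I \<Longrightarrow> f i \<in> hom_polys n v) \<Longrightarrow> (\<Sum>i\<in>I. f i) \<in> hom_polys n v"
  by (induction I rule: infinite_finite_induct)
    (simp_all add: hom_polys_add, simp_all add: hom_polys_def polys_def)

lemma single_mono_of_polys: "Poly_Mapping.single (mono_of n a) c \<in> polys n"
  using keys_mono_of by (auto simp: polys_def split: if_splits)

lemma single_mono_of_hom_polys:
  "(\<Sum>j<n. a j) = v \<Longrightarrow> Poly_Mapping.single (mono_of n a) c \<in> hom_polys n v"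
  using keys_mono_of by (auto simp: hom_polys_def polys_def mono_degree_mono_of split: if_splits)

lemma eval_mpoly_smult_hom:
  assumes f: "f \<in> hom_polys n v" and x: "x \<in> carrier_vec n"
  shows "eval_mpoly f (c \<cdot>\<^sub>v x) = c ^ v * eval_mpoly f x"
proof -
  have "mono_val (vec_index (c \<cdot>\<^sub>v x)) t = c ^ v * mono_val (vec_index x) t"
    if "t \<in> Poly_Mapping.keys f" for t
  proof -
    have t: "Poly_Mapping.keys t \<subseteq> {..<n}" "mono_degree t = v"
      using f that by (auto simp: hom_polys_def polys_def)
    then have "v = (\<Sum>j<n. Poly_Mapping.lookup t j)" using mono_degree_superset by blast
    then show ?thesis using x
      by (simp add: mono_val_superset[OF _ t(1)] power_mult_distrib prod.distrib power_sum)
  qed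
  then show ?thesis
    by (simp add: eval_mpoly_superset[of "Poly_Mapping.keys f"] sum_distrib_left mult.left_commute)
qed

section \<open>Binary forms\<close>

text \<open>A condition on values: over a finite field different coefficients can give the same F,
  and codewords see only F.\<close>

definition hom2 :: "nat \<Rightarrow> ('a::comm_semiring_1 \<Rightarrow> 'a \<Rightarrow> 'a) \<Rightarrow> bool" where
  "hom2 k F \<longleftrightarrow> (\<exists>p. \<forall>s t. F s t = (\<Sum>i\<le>k. p i * s ^ i * t ^ (k - i)))"

lemma hom2_add: "hom2 k F \<Longrightarrow> hom2 k G \<Longrightarrow> hom2 k (\<lambda>s t. F s t + G s t)"
proof -
  assume "hom2 k F" "hom2 k G"
  then obtain p r where "\<forall>s t. F s t = (\<Sum>i\<le>k. p i * s ^ i * t ^ (k - i))"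
    "\<forall>s t. G s t = (\<Sum>i\<le>k. r i * s ^ i * t ^ (k - i))" unfolding hom2_def by blast
  then show ?thesis unfolding hom2_def
    by (intro exI[of _ "\<lambda>i. p i + r i"]) (simp add: algebra_simps sum.distrib)
qed

lemma hom2_cmult: "hom2 k F \<Longrightarrow> hom2 k (\<lambda>s t. c * F s t)"
proof -
  assume "hom2 k F"
  then obtain p where "\<forall>s t. F s t = (\<Sum>i\<le>k. p i * s ^ i * t ^ (k - i))"
    unfolding hom2_def by blast
  then show ?thesis unfolding hom2_def
    by (intro exI[of _ "\<lambda>i. c * p i"]) (simp add: sum_distrib_left mult.assoc)
qed

lemma hom2_zero: "hom2 k (\<lambda>s t. 0)"
  unfolding hom2_def by (intro exI[of _ "\<lambda>_. 0"]) simp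

lemma hom2_sum: "(\<And>i. i \<in> I \<Longrightarrow> hom2 k (F i)) \<Longrightarrow> hom2 k (\<lambda>s t. \<Sum>i\<in>I. F i s t)"
  by (induction I rule: infinite_finite_induct) (auto simp: hom2_zero intro!: hom2_add)

lemma hom2_monom: "i \<le> k \<Longrightarrow> hom2 k (\<lambda>s t. s ^ i * t ^ (k - i))"
  unfolding hom2_def by (intro exI[of _ "\<lambda>j. if j = i then 1 else 0"]) (simp add: if_distrib if_distribR cong: if_cong)

lemma hom2_swap: "hom2 k F \<Longrightarrow> hom2 k (\<lambda>s t. F t s)"
proof -
  assume "hom2 k F"
  then obtain p where p: "\<forall>s t. F s t = (\<Sum>i\<le>k. p i * s ^ i * t ^ (k - i))"
    unfolding hom2_def by blast
  have "F t s = (\<Sum>i\<le>k. p (k - i) * s ^ i * t ^ (k - i))" for s t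
    unfolding p[rule_format]
    by (rule sum.reindex_bij_witness[of _ "\<lambda>i. k - i" "\<lambda>i. k - i"]) (auto simp: mult_ac)
  then show ?thesis unfolding hom2_def by (intro exI[of _ "\<lambda>i. p (k - i)"]) simp
qed

lemma hom2_mult_snd: "hom2 k F \<Longrightarrow> hom2 (Suc k) (\<lambda>s t. t * F s t)"
proof -
  assume "hom2 k F"
  then obtain p where p: "\<forall>s t. F s t = (\<Sum>i\<le>k. p i * s ^ i * t ^ (k - i))"
    unfolding hom2_def by blast
  have "t * F s t = (\<Sum>i\<le>Suc k. (if i \<le> k then p i else 0) * s ^ i * t ^ (Suc k - i))" for s t
    unfolding p[rule_format] by (simp add: sum_distrib_left Suc_diff_le mult_ac)
  then show ?thesis unfolding hom2_def by (intro exI[of _ "\<lambda>i. if i \<le> k then p i else 0"]) simp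
qed

lemma hom2_mult_linear: "hom2 k F \<Longrightarrow> hom2 (Suc k) (\<lambda>s t. (s * \<alpha> + t * \<beta>) * F s t)"
proof -
  assume F: "hom2 k F"
  have "hom2 (Suc k) (\<lambda>s t. s * F s t)" using hom2_swap[OF hom2_mult_snd[OF hom2_swap[OF F]]] .
  from hom2_add[OF hom2_cmult[OF this, of \<alpha>] hom2_cmult[OF hom2_mult_snd[OF F], of \<beta>]]
  show ?thesis by (simp add: algebra_simps)
qed

lemma hom2_mult_linear_power:
  "hom2 k F \<Longrightarrow> hom2 (b + k) (\<lambda>s t. (s * \<alpha> + t * \<beta>) ^ b * F s t)"
  by (induction b) (auto simp: mult.assoc intro: hom2_mult_linear)

text \<open>On a plane a monomial becomes a product of powers of linear forms in s and t; this keeps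
  track of the degree when a form is multiplied by it.\<close>

lemma hom2_mult_linear_prod:
  assumes "finite J" "hom2 k F"
  shows "hom2 ((\<Sum>j\<in>J. b j) + k) (\<lambda>s t. (\<Prod>j\<in>J. (s * \<alpha> j + t * \<beta> j) ^ b j) * F s t)"
  using assms by (induction J) (auto simp: mult.assoc add.assoc intro: hom2_mult_linear_power)

lemma hom2_const: "hom2 0 (\<lambda>s t. c)"
  unfolding hom2_def by auto

lemma hom2_linear_power: "hom2 k (\<lambda>s t. (s * \<alpha> + t * \<beta>) ^ k * c)"
  using hom2_mult_linear_power[OF hom2_const[of c], of k \<alpha> \<beta>] by simp

text \<open>For each monomial the double sum factors into two power sums. Their exponents add up to
  q - 1 > 0, so one of them is below q - 1 and its power sum is 0.\<close>

lemma hom2_double_sum: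
  assumes "hom2 (CARD('a) - 1) F"
  shows "(\<Sum>s\<in>UNIV. \<Sum>t\<in>UNIV. F s t :: 'a::{field,finite}) = 0"
proof -
  define N where "N = CARD('a) - 1"
  have N: "N > 0" using finite_field_card_gt_1[where 'a = 'a] by (simp add: N_def)
  obtain p where p: "\<forall>s t. F s t = (\<Sum>i\<le>N. p i * s ^ i * t ^ (N - i))"
    using assms unfolding hom2_def N_def by blast
  have "(\<Sum>s\<in>UNIV. \<Sum>t\<in>UNIV. F s t) = (\<Sum>s\<in>UNIV. \<Sum>i\<le>N. \<Sum>t\<in>UNIV. p i * s ^ i * t ^ (N - i))"
    unfolding p[rule_format] by (intro sum.cong refl sum.swap)
  also have "\<dots> = (\<Sum>i\<le>N. \<Sum>s\<in>UNIV. \<Sum>t\<in>UNIV. p i * s ^ i * t ^ (N - i))"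
    by (rule sum.swap)
  also have "\<dots> = (\<Sum>i\<le>N. p i * ((\<Sum>s\<in>UNIV. s ^ i) * (\<Sum>t\<in>UNIV. t ^ (N - i))))"
    unfolding sum_product by (simp add: sum_distrib_left mult.assoc)
  also have "\<dots> = (\<Sum>i\<le>N. 0)"
  proof (intro sum.cong refl)
    fix i
    have "i < N \<or> N - i < N" using N by linarith
    then show "p i * ((\<Sum>s\<in>UNIV. s ^ i) * (\<Sum>t\<in>UNIV. t ^ (N - i))) = 0"
      using finite_field_power_sum[of i, where 'a = 'a] finite_field_power_sum[of "N - i", where 'a = 'a]
      unfolding N_def by auto
  qed
  finally show ?thesis by simp
qed

section \<open>Functions that are forms on every plane\<close>

lemma nonzero_vec_index:
  assumes "v \<in> carrier_vec n" "v \<noteq> 0\<^sub>v n"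
  obtains i where "i < n" "v $ i \<noteq> 0"
proof -
  have "\<exists>i<n. v $ i \<noteq> 0"
  proof (rule ccontr)
    assume "\<not> ?thesis"
    then have "v = 0\<^sub>v n" using assms(1) by (intro eq_vecI) auto
    then show False using assms(2) by simp
  qed
  then show thesis using that by blast
qed

text \<open>The vectors u and v may be dependent, so the condition contains homogeneity on lines
  through the origin: take v = 0.\<close>

definition lift_hom :: "nat \<Rightarrow> nat \<Rightarrow> ('a::field vec \<Rightarrow> 'a) \<Rightarrow> bool" where
  "lift_hom n k g \<longleftrightarrow> (\<forall>u\<in>carrier_vec n. \<forall>v\<in>carrier_vec n. hom2 k (\<lambda>s t. g (s \<cdot>\<^sub>v u + t \<cdot>\<^sub>v v)))"

lemma lift_hom_scale:
  assumes g: "lift_hom n k g" and x: "x \<in> carrier_vec n"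
  shows "g (c \<cdot>\<^sub>v x) = c ^ k * g x"
proof -
  obtain p where p: "\<And>s t. g (s \<cdot>\<^sub>v x + t \<cdot>\<^sub>v 0\<^sub>v n) = (\<Sum>i\<le>k. p i * s ^ i * t ^ (k - i))"
    using g x unfolding lift_hom_def hom2_def by (meson zero_carrier_vec)
  have "g (s \<cdot>\<^sub>v x) = p k * s ^ k" for s
  proof -
    have "g (s \<cdot>\<^sub>v x) = (\<Sum>i\<le>k. p i * s ^ i * 0 ^ (k - i))"
    proof -
      have "s \<cdot>\<^sub>v x + 0 \<cdot>\<^sub>v 0\<^sub>v n = s \<cdot>\<^sub>v x" using x by (intro eq_vecI) auto
      then show ?thesis using p[of s 0] by simp
    qed
    \<comment> \<open>With t = 0 only the term without t survives, since 0^0 = 1.\<close>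
    also have "\<dots> = (\<Sum>i\<le>k. if i = k then p k * s ^ k else 0)"
      by (intro sum.cong) (auto simp: power_0_left)
    finally show ?thesis by simp
  qed
  from this[of c] this[of 1] show ?thesis by simp
qed

lemma lift_hom_zero:
  assumes "lift_hom n k g" "k \<ge> 1"
  shows "g (0\<^sub>v n) = 0"
proof -
  have "g (0 \<cdot>\<^sub>v 0\<^sub>v n) = 0 ^ k * g (0\<^sub>v n)" by (rule lift_hom_scale[OF assms(1)]) simp
  moreover have "0 \<cdot>\<^sub>v 0\<^sub>v n = (0\<^sub>v n :: 'a vec)" by (intro eq_vecI) auto
  ultimately show ?thesis using assms(2) by (simp add: power_0_left)
qed

lemma sum_carrier_vec_smult:
  assumes "(c::'a::{field,finite}) \<noteq> 0"
  shows "(\<Sum>y\<in>carrier_vec n. f (c \<cdot>\<^sub>v y)) = (\<Sum>y\<in>carrier_vec n. f y)"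
proof (rule sum.reindex_bij_betw)
  show "bij_betw (\<lambda>y. c \<cdot>\<^sub>v y) (carrier_vec n) (carrier_vec n)"
    using assms by (intro bij_betwI[where g = "\<lambda>y. inverse c \<cdot>\<^sub>v y"]) (auto simp: smult_smult_assoc)
qed

text \<open>Replacing y by c * y in the defining sum brings out c^k from g and the inverse of c^(sum
  of a) from the indicator coefficients. A nonzero coefficient therefore has degree congruent to k
  modulo q - 1.\<close>

lemma interp_coeff_scale:
  fixes g :: "'a::{field,finite} vec \<Rightarrow> 'a"
  assumes g: "lift_hom n k g" and a: "a \<in> exponents n TYPE('a)" and c: "c \<noteq> 0"
  shows "c ^ (\<Sum>j<n. a j) * interp_coeff n g a = c ^ k * interp_coeff n g a"
proof -
  have "interp_coeff n g a = (\<Sum>y\<in>carrier_vec n. g (c \<cdot>\<^sub>v y) * (\<Prod>j<n. delta_coeff (a j) ((c \<cdot>\<^sub>v y) $ j)))"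
    unfolding interp_coeff_def
    by (rule sum_carrier_vec_smult[OF c, symmetric])
  also have "\<dots> = (\<Sum>y\<in>carrier_vec n. c ^ k * g y * (\<Prod>j<n. delta_coeff (a j) (c * (y $ j))))"
    by (intro sum.cong refl arg_cong2[where f = "(*)"] prod.cong) (auto simp: lift_hom_scale[OF g])
  finally have "c ^ (\<Sum>j<n. a j) * interp_coeff n g a =
     (\<Sum>y\<in>carrier_vec n. c ^ k * g y * (\<Prod>j<n. delta_coeff (a j) (c * (y $ j)) * c ^ a j))"
    by (simp add: power_sum sum_distrib_left prod.distrib mult_ac)
  also have "\<dots> = (\<Sum>y\<in>carrier_vec n. c ^ k * g y * (\<Prod>j<n. delta_coeff (a j) (y $ j)))"
    using a by (intro sum.cong refl arg_cong2[where f = "(*)"] prod.cong)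
      (auto simp: exponents_def intro!: delta_coeff_scale[OF c])
  finally show ?thesis by (simp add: interp_coeff_def sum_distrib_left mult.assoc)
qed

text \<open>For exponent 0 everywhere the weight of y is the product of the 1 - (y $ j)^(q - 1), the
  indicator of the zero vector, where g vanishes.\<close>

lemma interp_coeff_degree_pos:
  fixes g :: "'a::{field,finite} vec \<Rightarrow> 'a"
  assumes g: "lift_hom n k g" "k \<ge> 1" and nz: "interp_coeff n g a \<noteq> 0"
  shows "(\<Sum>j<n. a j) > 0"
proof (rule ccontr)
  assume "\<not> ?thesis"
  then have a: "a j = 0" if "j < n" for j using that by simp
  have q: "CARD('a) - 1 > 0" using finite_field_card_gt_1[where 'a = 'a] by simp
  have "g y * (\<Prod>j<n. delta_coeff (a j) (y $ j)) = 0" if y: "y \<in> carrier_vec n" for y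
  proof (cases "y = 0\<^sub>v n")
    case True
    then show ?thesis using lift_hom_zero[OF g] by simp
  next
    case False
    then obtain j where j: "j < n" "y $ j \<noteq> 0" using nonzero_vec_index[OF y] by blast
    then have "delta_coeff (a j) (y $ j) = 0"
      using finite_field_power_card_minus_1[of "y $ j"] a by (simp add: delta_coeff_def)
    then show ?thesis using j(1) by (auto simp: prod_zero_iff)
  qed
  then show False using nz by (simp add: interp_coeff_def)
qed

text \<open>Parametrising the planes through the first unit vector by \<open>v\<close> with \<open>v $ 0 = 0\<close>, the terms with
  \<open>t \<noteq> 0\<close> count every vector \<open>q - 1\<close> times, and those with \<open>t = 0\<close> count the common line a number of
  times divisible by the characteristic.\<close>

lemma sum_planes:
  fixes G :: "'a::{field,finite} vec \<Rightarrow> 'a"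
  assumes n: "n \<ge> 2"
    and G: "\<And>v. v \<in> carrier_vec n \<Longrightarrow>
       (\<Sum>s\<in>UNIV. \<Sum>t\<in>UNIV. G (s \<cdot>\<^sub>v unit_vec n 0 + t \<cdot>\<^sub>v v)) = 0"
  shows "(\<Sum>y\<in>carrier_vec n. G y) = 0"
proof -
  define W where "W = {v \<in> carrier_vec n. v $ 0 = (0::'a)}"
  define Z where "Z = (\<Sum>y\<in>carrier_vec n. G y)"
  define I where "I t = (\<Sum>v\<in>W. \<Sum>s\<in>UNIV. G (s \<cdot>\<^sub>v unit_vec n 0 + t \<cdot>\<^sub>v v))" for t
  have finW: "finite W" unfolding W_def by (rule finite_subset[OF _ finite_carrier_vec]) auto
  \<comment> \<open>Adding the unit vector of index 1 permutes \<open>W\<close>, as n is at least 2,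
    and raises the sum of the coordinates of index 1 by the size of \<open>W\<close>. So this size
    is 0 in the field.\<close>
  have "(\<Sum>v\<in>W. v $ 1) = (\<Sum>v\<in>W. (v + unit_vec n 1) $ 1)"
    using n by (intro sum.reindex_bij_betw[symmetric, of "\<lambda>v. v + unit_vec n 1" W W "\<lambda>v. v $ 1"]
        bij_betwI[where g = "\<lambda>v. v - unit_vec n 1"]) (auto simp: W_def)
  also have "\<dots> = (\<Sum>v\<in>W. v $ 1 + 1)"
    using n by (intro sum.cong) (auto simp: W_def)
  finally have cardW: "(of_nat (card W) :: 'a) = 0" by (simp add: sum.distrib)
  have I0: "I 0 = 0"
  proof -
    have "I 0 = (\<Sum>v\<in>W. \<Sum>s\<in>UNIV. G (s \<cdot>\<^sub>v unit_vec n 0))"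
      unfolding I_def by (intro sum.cong refl arg_cong[where f = G]) (auto simp: W_def)
    also have "\<dots> = 0" by (simp add: cardW)
    finally show ?thesis .
  qed
  have It: "I t = Z" if t: "t \<noteq> 0" for t
  proof -
    have "I t = (\<Sum>v\<in>W. \<Sum>s\<in>UNIV. G (s \<cdot>\<^sub>v unit_vec n 0 + v))"
      unfolding I_def
      by (rule sum.reindex_bij_betw[of "\<lambda>v. t \<cdot>\<^sub>v v" W W "\<lambda>v. \<Sum>s\<in>UNIV. G (s \<cdot>\<^sub>v unit_vec n 0 + v)"],
          rule bij_betwI[where g = "\<lambda>v. inverse t \<cdot>\<^sub>v v"])
         (use t n in \<open>auto simp: W_def smult_smult_assoc\<close>)
    also have "\<dots> = (\<Sum>(v, s)\<in>W \<times> UNIV. G (s \<cdot>\<^sub>v unit_vec n 0 + v))"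
      by (simp add: sum.cartesian_product)
    also have "\<dots> = Z" unfolding Z_def
      by (rule sum.reindex_bij_witness[of _ "\<lambda>y. (y - (y $ 0) \<cdot>\<^sub>v unit_vec n 0, y $ 0)"
            "\<lambda>(v, s). s \<cdot>\<^sub>v unit_vec n 0 + v"])
         (use n in \<open>auto simp: W_def intro!: eq_vecI\<close>)
    finally show ?thesis .
  qed
  have "0 = (\<Sum>v\<in>W. \<Sum>s\<in>UNIV. \<Sum>t\<in>UNIV. G (s \<cdot>\<^sub>v unit_vec n 0 + t \<cdot>\<^sub>v v))"
    by (rule sum.neutral[symmetric]) (auto simp: W_def intro!: G)
  also have "\<dots> = (\<Sum>v\<in>W. \<Sum>t\<in>UNIV. \<Sum>s\<in>UNIV. G (s \<cdot>\<^sub>v unit_vec n 0 + t \<cdot>\<^sub>v v))"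
    by (intro sum.cong refl sum.swap)
  also have "\<dots> = (\<Sum>t\<in>UNIV. I t)" unfolding I_def by (rule sum.swap)
  also have "\<dots> = I 0 + (\<Sum>t\<in>UNIV - {0}. I t)" by (rule sum.remove) auto
  also have "\<dots> = of_nat (CARD('a) - 1) * Z"
    by (simp add: I0 It card_Diff_singleton)
  \<comment> \<open>In the field q - 1 is -1.\<close>
  also have "\<dots> = - Z"
    using finite_field_card_gt_1[where 'a = 'a] by (simp add: of_nat_diff of_nat_CARD_eq_0)
  finally show ?thesis by (simp add: Z_def)
qed

lemma interp_coeff_top_degree:
  fixes g :: "'a::{field,finite} vec \<Rightarrow> 'a"
  assumes g: "lift_hom (m + 1) k g" and m: "m \<ge> 1" and k: "1 \<le> k" "k \<le> CARD('a) - 1"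
    and a: "a \<in> exponents (m + 1) TYPE('a)" and deg: "(\<Sum>j<m + 1. a j) = k + m * (CARD('a) - 1)"
  shows "interp_coeff (m + 1) g a = 0"
proof -
  define n N where "n = m + 1" and "N = CARD('a) - 1"
  have N: "N > 0" using finite_field_card_gt_1[where 'a = 'a] by (simp add: N_def)
  have aN: "a j \<le> N" if "j < n" for j
    using PiE_mem[OF a[unfolded exponents_def], of j] that by (simp add: n_def N_def)
  define b where "b j = N - a j" for j
  have "(\<Sum>j<n. b j) + (\<Sum>j<n. a j) = (\<Sum>j<n. N)"
    unfolding sum.distrib[symmetric] using aN by (intro sum.cong) (auto simp: b_def)
  \<comment> \<open>The complementary exponents have total (m + 1)N - (k + mN) = N - k.\<close>
  then have sb: "(\<Sum>j<n. b j) + k = N"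
    using deg unfolding n_def[symmetric] N_def[symmetric] by (simp add: n_def)
  \<comment> \<open>An exponent 0 would make one complementary exponent N, more than their total N -
    k. So no factor is the exceptional coefficient of index 0, and each one is -(y^b).\<close>
  have pos: "a j \<noteq> 0" if "j < n" for j
  proof
    assume "a j = 0"
    then have "N \<le> (\<Sum>j<n. b j)" using member_le_sum[of j "{..<n}" b] that by (simp add: b_def)
    then show False using sb k by simp
  qed
  define G where "G y = (\<Prod>j<n. (y $ j) ^ b j) * g y" for y
  have "(\<Sum>y\<in>carrier_vec n. G y) = 0"
  proof (rule sum_planes)
    show "n \<ge> 2" using m by (simp add: n_def)
    fix v :: "'a vec" assume v: "v \<in> carrier_vec n"
    define u :: "'a vec" where "u = unit_vec n 0"
    have u: "u \<in> carrier_vec n" by (simp add: u_def)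
    have "hom2 k (\<lambda>s t. g (s \<cdot>\<^sub>v u + t \<cdot>\<^sub>v v))"
      using g u v unfolding lift_hom_def n_def by blast
    from hom2_mult_linear_prod[OF _ this, of "{..<n}" b "vec_index u" "vec_index v"]
    have "hom2 N (\<lambda>s t. (\<Prod>j<n. (s * u $ j + t * v $ j) ^ b j) * g (s \<cdot>\<^sub>v u + t \<cdot>\<^sub>v v))"
      by (simp add: sb)
    also have "(\<lambda>s t. (\<Prod>j<n. (s * u $ j + t * v $ j) ^ b j) * g (s \<cdot>\<^sub>v u + t \<cdot>\<^sub>v v)) =
        (\<lambda>s t. G (s \<cdot>\<^sub>v u + t \<cdot>\<^sub>v v))"
      unfolding G_def using u v by (intro ext arg_cong2[where f = "(*)"] prod.cong refl) auto
    finally show "(\<Sum>s\<in>UNIV. \<Sum>t\<in>UNIV. G (s \<cdot>\<^sub>v unit_vec n 0 + t \<cdot>\<^sub>v v)) = 0"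
      unfolding N_def u_def by (rule hom2_double_sum)
  qed
  moreover have "interp_coeff n g a = (-1) ^ n * (\<Sum>y\<in>carrier_vec n. G y)"
  proof -
    have "(\<Prod>j<n. delta_coeff (a j) (y $ j)) = (-1) ^ n * (\<Prod>j<n. (y $ j) ^ b j)" for y :: "'a vec"
    proof -
      have "(\<Prod>j<n. delta_coeff (a j) (y $ j)) = (\<Prod>j<n. (-1) * (y $ j) ^ b j)"
        using pos by (intro prod.cong) (auto simp: delta_coeff_def b_def N_def)
      then show ?thesis by (simp only: prod.distrib) simp
    qed
    then show ?thesis by (simp add: interp_coeff_def G_def sum_distrib_left mult_ac)
  qed
  ultimately show ?thesis by (simp add: n_def)
qed

lemma lift_hom_imp_hom_poly:
  fixes g :: "'a::{field,finite} vec \<Rightarrow> 'a"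
  assumes g: "lift_hom (m + 1) k g" and m: "m \<ge> 1" and k: "1 \<le> k" "k \<le> CARD('a) - 1"
  shows "\<exists>f\<in>hom_polys (m + 1) (k + (m - 1) * (CARD('a) - 1)).
           \<forall>x\<in>carrier_vec (m + 1). eval_mpoly f x = g x"
proof -
  define n N v where "n = m + 1" and "N = CARD('a) - 1" and "v = k + (m - 1) * N"
  have N: "N > 0" using finite_field_card_gt_1[where 'a = 'a] by (simp add: N_def)
  define A where "A = {a \<in> exponents n TYPE('a). interp_coeff n g a \<noteq> 0}"
  have raise: "\<exists>a'. (\<Sum>j<n. a' j) = v \<and> (\<forall>x::nat \<Rightarrow> 'a. (\<Prod>j<n. x j ^ a' j) = (\<Prod>j<n. x j ^ a j))"
    if a: "a \<in> A" for a
  proof -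
    define d where "d = (\<Sum>j<n. a j)"
    have ex: "a \<in> exponents n TYPE('a)" and nz: "interp_coeff n g a \<noteq> 0"
      using a by (auto simp: A_def)
    have d0: "d > 0"
      using interp_coeff_degree_pos[OF g k(1)] nz unfolding d_def n_def by simp
    have "c ^ d = c ^ k" if "c \<noteq> 0" for c :: 'a
      using interp_coeff_scale[OF g ex[unfolded n_def] that] nz unfolding d_def n_def by simp
    then have dk: "d mod N = k mod N"
      unfolding N_def by (rule finite_field_power_eq_imp_mod_eq)
    have "a j \<le> N" if "j < n" for j
      using PiE_mem[OF ex[unfolded exponents_def], of j] that by (simp add: N_def)
    then have "d \<le> (\<Sum>j<n. N)" unfolding d_def by (intro sum_mono) auto
    then have dn: "d \<le> N + m * N" by (simp add: n_def)
    have dtop: "d \<noteq> k + m * N"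
      using interp_coeff_top_degree[OF g m k] ex nz unfolding d_def n_def N_def by blast
    have dv: "d \<le> v"
    proof (rule ccontr)
      assume "\<not> d \<le> v"
      then have "v < d" by simp
      moreover have "v mod N = d mod N" using dk by (simp add: v_def)
      ultimately obtain l where l: "d = v + N * l"
        by (metis less_imp_le mod_eq_nat2E)
      with \<open>v < d\<close> have "l \<ge> 1" by (cases l) auto
      have "m * N = (m - 1) * N + N" using m by (cases m) auto
      have "l \<noteq> 1" using l dtop \<open>m * N = _\<close> by (auto simp: v_def)
      \<comment> \<open>The case l = 1 is the excluded top degree, and v + 2N = k + (m + 1)N is
        beyond the largest degree of a reduced monomial because k is positive.\<close>
      then have "N * 2 \<le> N * l" using \<open>l \<ge> 1\<close> by (intro mult_le_mono2) linarith
      then show False using l dn \<open>m * N = _\<close> k unfolding v_def by linarith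
    qed
    \<comment> \<open>The excess v - d must go to a variable that already occurs, since raising an
      exponent 0 would change the value where that variable is 0.\<close>
    obtain j0 where j0: "j0 < n" "a j0 > 0"
      using d0 unfolding d_def by (metis gr0I lessThan_iff sum.neutral)
    have "v mod N = d mod N" using dk by (simp add: v_def)
    define a' where "a' = a(j0 := a j0 + (v - d))"
    have "N dvd v - d" using \<open>v mod N = d mod N\<close> dv by (simp add: mod_eq_dvd_iff_nat)
    then have "a' j0 mod N = a j0 mod N" by (auto simp: a'_def elim!: dvdE)
    then have pw: "z ^ a' j = z ^ a j" for z :: 'a and j
      using finite_field_power_mod_eq[of "a' j0" "a j0" z] j0(2) unfolding N_def a'_def by (cases "j = j0") auto
    have "(\<Sum>j<n. a' j) = a' j0 + (\<Sum>j\<in>{..<n} - {j0}. a' j)"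
      using j0 by (intro sum.remove) auto
    also have "\<dots> = (v - d) + (a j0 + (\<Sum>j\<in>{..<n} - {j0}. a j))"
      by (simp add: a'_def)
    also have "a j0 + (\<Sum>j\<in>{..<n} - {j0}. a j) = d"
      unfolding d_def using j0 by (intro sum.remove[symmetric]) auto
    finally have "(\<Sum>j<n. a' j) = v" using dv by simp
    then show ?thesis using pw by auto
  qed
  then obtain r where r: "\<And>a. a \<in> A \<Longrightarrow> (\<Sum>j<n. r a j) = v"
    "\<And>a (x::nat \<Rightarrow> 'a). a \<in> A \<Longrightarrow> (\<Prod>j<n. x j ^ r a j) = (\<Prod>j<n. x j ^ a j)"
    by metis
  define f where "f = (\<Sum>a\<in>A. Poly_Mapping.single (mono_of n (r a)) (interp_coeff n g a))"
  have "f \<in> hom_polys n v"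
    unfolding f_def by (intro hom_polys_sum single_mono_of_hom_polys r(1))
  moreover have "eval_mpoly f x = g x" if x: "x \<in> carrier_vec n" for x
  proof -
    have "eval_mpoly f x = (\<Sum>a\<in>A. interp_coeff n g a * (\<Prod>j<n. (x $ j) ^ a j))"
      by (simp add: f_def eval_mpoly_sum mono_val_mono_of r(2))
    also have "\<dots> = (\<Sum>a\<in>exponents n TYPE('a). interp_coeff n g a * (\<Prod>j<n. (x $ j) ^ a j))"
      by (intro sum.mono_neutral_left) (auto simp: A_def finite_exponents)
    finally show ?thesis using interpolation[OF x, of g] by simp
  qed
  ultimately show ?thesis unfolding n_def v_def N_def by blast
qed

text \<open>Every function is polynomial, so membership in \<open>Lift\<close> becomes a condition
  on values alone.\<close>

lemma function_imp_poly:
  fixes g :: "'a::{field,finite} vec \<Rightarrow> 'a"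
  shows "\<exists>f\<in>polys n. \<forall>x\<in>carrier_vec n. eval_mpoly f x = g x"
proof -
  define f where "f = (\<Sum>a\<in>exponents n TYPE('a). Poly_Mapping.single (mono_of n a) (interp_coeff n g a))"
  have "f \<in> polys n" unfolding f_def by (intro polys_sum single_mono_of_polys)
  moreover have "eval_mpoly f x = g x" if "x \<in> carrier_vec n" for x
    using interpolation[OF that, of g] by (simp add: f_def eval_mpoly_sum mono_val_mono_of)
  ultimately show ?thesis by blast
qed

section \<open>The codes as sets of functions\<close>

text \<open>The direction b may be 0, as \<open>emb_aff\<close> also contains matrices with second
  column 0; the restriction is then constant.\<close>

definition lift_aff :: "nat \<Rightarrow> nat \<Rightarrow> ('a::field vec \<Rightarrow> 'a) \<Rightarrow> bool" where
  "lift_aff n d h \<longleftrightarrow> (\<forall>a\<in>carrier_vec n. \<forall>b\<in>carrier_vec n.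
     \<exists>p. Polynomial.degree p \<le> d \<and> (\<forall>t. h (a + t \<cdot>\<^sub>v b) = poly p t))"

section \<open>Standard representatives of projective points\<close>

definition normalized :: "nat \<Rightarrow> 'a::field vec \<Rightarrow> bool" where
  "normalized m v \<longleftrightarrow> v \<in> carrier_vec (m + 1) \<and> (\<exists>i<m + 1. v $ i = 1 \<and> (\<forall>j<i. v $ j = 0))"

text \<open>Some coordinate of c * u is 1, so c is not 0 and scaling preserves the zero pattern. The
  leading positions agree, and comparing the entries there gives c = 1.\<close>

lemma normalized_smult_unique:
  assumes u: "normalized m u" and cu: "normalized m (c \<cdot>\<^sub>v u)"
  shows "c \<cdot>\<^sub>v u = u"
proof -
  obtain i where i: "i < m + 1" "u $ i = 1" "\<And>j. j < i \<Longrightarrow> u $ j = 0" and cm: "u \<in> carrier_vec (m + 1)"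
    using u unfolding normalized_def by blast
  obtain l where l: "l < m + 1" "(c \<cdot>\<^sub>v u) $ l = 1" "\<And>j. j < l \<Longrightarrow> (c \<cdot>\<^sub>v u) $ j = 0"
    using cu unfolding normalized_def by blast
  have "c * u $ l = 1" "\<And>j. j < l \<Longrightarrow> c * u $ j = 0" using l cm by auto
  then have "l = i" using i l(1) cm by (metis linorder_neqE_nat mult_zero_right mult_eq_0_iff zero_neq_one)
  then have "c = 1" using \<open>c * u $ l = 1\<close> i by simp
  then show ?thesis by simp
qed

lemma normalized_nonzero: "normalized m u \<Longrightarrow> u \<in> carrier_vec (m + 1) - {0\<^sub>v (m + 1)}"
  unfolding normalized_def by auto

lemma proj_pt_normalized:
  assumes u: "normalized m u"
  shows "proj_pt m u \<in> proj_space m" "std_rep (proj_pt m u) = u"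
proof -
  note nz = normalized_nonzero[OF u]
  show "proj_pt m u \<in> proj_space m"
    unfolding proj_pt_def proj_space_def using nz by (intro quotientI) auto
  have mem: "v \<in> proj_pt m u \<longleftrightarrow> v \<in> carrier_vec (m + 1) - {0\<^sub>v (m + 1)} \<and> (\<exists>c. c \<noteq> 0 \<and> v = c \<cdot>\<^sub>v u)" for v
    using nz by (auto simp: proj_pt_def proj_rel_def)
  show "std_rep (proj_pt m u) = u" unfolding std_rep_def
  proof (rule the_equality)
    show "u \<in> proj_pt m u \<and> (\<exists>i<dim_vec u. u $ i = 1 \<and> (\<forall>j<i. u $ j = 0))"
      using u nz unfolding mem by (auto simp: normalized_def intro!: exI[of _ "1::'a"])
    fix v assume v: "v \<in> proj_pt m u \<and> (\<exists>i<dim_vec v. v $ i = 1 \<and> (\<forall>j<i. v $ j = 0))"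
    then obtain c where c: "v = c \<cdot>\<^sub>v u" "v \<in> carrier_vec (m + 1)" unfolding mem by auto
    then have "normalized m v" using v by (auto simp: normalized_def)
    then show "v = u" using normalized_smult_unique[OF u] c by blast
  qed
qed

lemma nonzero_vec_normalize:
  assumes v: "v \<in> carrier_vec (m + 1)" "v \<noteq> 0\<^sub>v (m + 1)"
  obtains c where "c \<noteq> 0" "normalized m (c \<cdot>\<^sub>v v)"
proof -
  have ex: "\<exists>i. i < m + 1 \<and> v $ i \<noteq> 0" using nonzero_vec_index[OF v] by blast
  define i where "i = (LEAST i. i < m + 1 \<and> v $ i \<noteq> 0)"
  have i: "i < m + 1" "v $ i \<noteq> 0" using LeastI_ex[OF ex] by (auto simp: i_def)
  have less: "v $ j = 0" if "j < i" for j
    using not_less_Least[OF that[unfolded i_def]] that i by auto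
  have "normalized m (inverse (v $ i) \<cdot>\<^sub>v v)"
    unfolding normalized_def using v i less by (auto intro!: exI[of _ i])
  then show thesis using that[of "inverse (v $ i)"] i by simp
qed

text \<open>The zero vector is included, with factor 0, so that a function homogeneous under all
  scalars is determined by its values at normalized vectors.\<close>

lemma vec_normalize:
  fixes v :: "'a::field vec"
  assumes v: "v \<in> carrier_vec (m + 1)"
  obtains c u where "normalized m u" "v = c \<cdot>\<^sub>v u"
proof (cases "v = 0\<^sub>v (m + 1)")
  case True
  have "normalized m (unit_vec (m + 1) 0 :: 'a vec)" unfolding normalized_def by (auto intro!: exI[of _ 0])
  moreover have "v = 0 \<cdot>\<^sub>v unit_vec (m + 1) 0" using True by (intro eq_vecI) auto
  ultimately show thesis by (rule that)
next
  case False
  then obtain c where "c \<noteq> 0" "normalized m (c \<cdot>\<^sub>v v)" using nonzero_vec_normalize[OF v] by blast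
  then show thesis using that[of "c \<cdot>\<^sub>v v" "inverse c"] by (simp add: smult_smult_assoc)
qed

lemma proj_space_cases:
  assumes "P \<in> proj_space m"
  obtains u where "normalized m u" "P = proj_pt m u"
proof -
  obtain v where v: "v \<in> carrier_vec (m + 1)" "v \<noteq> 0\<^sub>v (m + 1)" "P = proj_rel m `` {v}"
    using assms unfolding proj_space_def by (auto elim!: quotientE)
  obtain c where c: "c \<noteq> 0" and norm: "normalized m (c \<cdot>\<^sub>v v)" using nonzero_vec_normalize[OF v(1,2)] .
  have nz: "c \<cdot>\<^sub>v v \<in> carrier_vec (m + 1) - {0\<^sub>v (m + 1)}" using normalized_nonzero[OF norm] .
  have "(\<exists>d. d \<noteq> 0 \<and> w = d \<cdot>\<^sub>v v) \<longleftrightarrow> (\<exists>d. d \<noteq> 0 \<and> w = d \<cdot>\<^sub>v (c \<cdot>\<^sub>v v))" for w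
  proof
    assume "\<exists>d. d \<noteq> 0 \<and> w = d \<cdot>\<^sub>v v"
    then obtain d where "d \<noteq> 0" "w = d \<cdot>\<^sub>v v" by blast
    then show "\<exists>d. d \<noteq> 0 \<and> w = d \<cdot>\<^sub>v (c \<cdot>\<^sub>v v)"
      using c by (intro exI[of _ "d / c"]) (simp add: smult_smult_assoc)
  next
    assume "\<exists>d. d \<noteq> 0 \<and> w = d \<cdot>\<^sub>v (c \<cdot>\<^sub>v v)"
    then obtain d where "d \<noteq> 0" "w = d \<cdot>\<^sub>v (c \<cdot>\<^sub>v v)" by blast
    then show "\<exists>d. d \<noteq> 0 \<and> w = d \<cdot>\<^sub>v v"
      using c by (intro exI[of _ "d * c"]) (simp add: smult_smult_assoc)
  qed
  then have "P = proj_pt m (c \<cdot>\<^sub>v v)"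
    using v(1,2) nz unfolding v(3) proj_pt_def proj_rel_def by auto
  then show thesis using that norm by blast
qed

text \<open>Extends \<open>ev_proj\<close> from polynomials to arbitrary functions on
  vectors.\<close>

definition codeword :: "nat \<Rightarrow> ('a::field vec \<Rightarrow> 'a) \<Rightarrow> 'a vec set \<Rightarrow> 'a" where
  "codeword m g = (\<lambda>P. if P \<in> proj_space m then g (std_rep P) else 0)"

lemma codeword_eq_iff:
  "codeword m g = codeword m h \<longleftrightarrow> (\<forall>u. normalized m u \<longrightarrow> g u = h u)"
proof
  assume eq: "codeword m g = codeword m h"
  show "\<forall>u. normalized m u \<longrightarrow> g u = h u"
  proof (intro allI impI)
    fix u :: "'a vec" assume "normalized m u"
    then show "g u = h u" using fun_cong[OF eq, of "proj_pt m u"]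
      by (simp add: codeword_def proj_pt_normalized)
  qed
next
  assume eq: "\<forall>u. normalized m u \<longrightarrow> g u = h u"
  show "codeword m g = codeword m h"
  proof
    fix P
    show "codeword m g P = codeword m h P"
    proof (cases "P \<in> proj_space m")
      case True
      then obtain u where "normalized m u" "P = proj_pt m u" by (rule proj_space_cases)
      then show ?thesis using eq by (simp add: codeword_def proj_pt_normalized)
    qed (simp add: codeword_def)
  qed
qed

lemma ev_proj_eq_codeword: "ev_proj m f = codeword m (eval_mpoly f)"
  by (simp add: ev_proj_def codeword_def)

section \<open>Binary forms as polynomials, planes as matrices, and the projective code\<close>

lemma hom2_imp_hom_poly:
  assumes "hom2 k F"
  shows "\<exists>f\<in>hom_polys 2 k. \<forall>x. eval_mpoly f x = F (x $ 0) (x $ 1)"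
proof -
  obtain p where p: "\<forall>s t. F s t = (\<Sum>i\<le>k. p i * s ^ i * t ^ (k - i))"
    using assms unfolding hom2_def by blast
  define f where "f = (\<Sum>i\<le>k. Poly_Mapping.single (mono_of 2 (\<lambda>j. if j = 0 then i else k - i)) (p i))"
  have "f \<in> hom_polys 2 k" unfolding f_def
    by (intro hom_polys_sum single_mono_of_hom_polys) (auto simp: numeral_2_eq_2)
  moreover have "eval_mpoly f x = F (x $ 0) (x $ 1)" for x
    by (simp add: p f_def eval_mpoly_sum mono_val_mono_of numeral_2_eq_2 mult.assoc)
  ultimately show ?thesis by blast
qed

lemma hom_poly_imp_hom2:
  assumes f: "f \<in> hom_polys 2 k"
  shows "\<exists>F. hom2 k F \<and> (\<forall>x. eval_mpoly f x = F (x $ 0) (x $ 1))"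
proof -
  define F where "F s t = (\<Sum>m\<in>Poly_Mapping.keys f. Poly_Mapping.lookup f m *
     (s ^ Poly_Mapping.lookup m 0 * t ^ Poly_Mapping.lookup m 1))" for s t
  have m: "Poly_Mapping.keys m \<subseteq> {..<2}" "mono_degree m = k" if "m \<in> Poly_Mapping.keys f" for m
    using f that by (auto simp: hom_polys_def polys_def)
  have "Poly_Mapping.lookup m 0 + Poly_Mapping.lookup m 1 = k" if "m \<in> Poly_Mapping.keys f" for m
    using mono_degree_superset[OF _ m(1)[OF that]] m(2)[OF that] by (simp add: numeral_2_eq_2)
  then have "hom2 k (\<lambda>s t. s ^ Poly_Mapping.lookup m 0 * t ^ Poly_Mapping.lookup m 1)"
    if "m \<in> Poly_Mapping.keys f" for m
    using hom2_monom[of "Poly_Mapping.lookup m 0" k] that by (metis add_diff_cancel_left' le_add1)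
  then have "hom2 k F" unfolding F_def by (intro hom2_sum hom2_cmult)
  moreover have "eval_mpoly f x = F (x $ 0) (x $ 1)" for x
    unfolding F_def eval_mpoly_superset[OF finite_keys subset_refl]
    using m by (intro sum.cong refl) (simp add: mono_val_superset[of "{..<2}"] numeral_2_eq_2)
  ultimately show ?thesis by blast
qed

lemma mult_mat_of_cols_2:
  fixes u v :: "'a::field vec"
  assumes u: "u \<in> carrier_vec n" and v: "v \<in> carrier_vec n"
  defines "L \<equiv> mat_of_cols n [u, v]"
  shows "L \<in> carrier_mat n 2"
    and "x \<in> carrier_vec 2 \<Longrightarrow> L *\<^sub>v x = x $ 0 \<cdot>\<^sub>v u + x $ 1 \<cdot>\<^sub>v v"
proof -
  show L: "L \<in> carrier_mat n 2" by (simp add: L_def numeral_2_eq_2 mat_of_cols_def)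
  assume x: "x \<in> carrier_vec 2"
  show "L *\<^sub>v x = x $ 0 \<cdot>\<^sub>v u + x $ 1 \<cdot>\<^sub>v v"
    using u v x L by (intro eq_vecI) (auto simp: L_def scalar_prod_def numeral_2_eq_2 mat_of_cols_def mult.commute)
qed

lemma mult_mat_vec_2:
  fixes L :: "'a::field mat"
  assumes L: "L \<in> carrier_mat n 2" and x: "x \<in> carrier_vec 2"
  shows "L *\<^sub>v x = x $ 0 \<cdot>\<^sub>v col L 0 + x $ 1 \<cdot>\<^sub>v col L 1"
proof (rule eq_vecI)
  fix i assume "i < dim_vec (x $ 0 \<cdot>\<^sub>v col L 0 + x $ 1 \<cdot>\<^sub>v col L 1)"
  then have i: "i < n" using L by simp
  show "(L *\<^sub>v x) $ i = (x $ 0 \<cdot>\<^sub>v col L 0 + x $ 1 \<cdot>\<^sub>v col L 1) $ i"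
    unfolding index_mult_mat_vec_2[OF L x i] using L i by (simp add: mult.commute)
qed (use L in simp)

text \<open>The difference of two vectors with the same image is a nontrivial linear relation
  between u and v, which expresses one of them through the other.\<close>

lemma not_inj_imp_proportional:
  fixes u v :: "'a::field vec"
  assumes u: "u \<in> carrier_vec n" and v: "v \<in> carrier_vec n"
    and ninj: "\<not> inj_on (\<lambda>x. mat_of_cols n [u, v] *\<^sub>v x) (carrier_vec 2)"
  obtains w \<alpha> \<beta> where "w \<in> carrier_vec n" "u = \<alpha> \<cdot>\<^sub>v w" "v = \<beta> \<cdot>\<^sub>v w"
proof -
  obtain x y where xy: "x \<in> carrier_vec 2" "y \<in> carrier_vec 2" "x \<noteq> y"
    "mat_of_cols n [u, v] *\<^sub>v x = mat_of_cols n [u, v] *\<^sub>v y"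
    using ninj unfolding inj_on_def by blast
  define a b where "a = x $ 0 - y $ 0" and "b = x $ 1 - y $ 1"
  have ab: "a \<noteq> 0 \<or> b \<noteq> 0"
  proof (rule ccontr)
    assume "\<not> ?thesis"
    then have "x = y" using xy(1,2) by (intro eq_vecI) (auto simp: a_def b_def less_2_cases_iff)
    then show False using xy(3) by simp
  qed
  have "x $ 0 \<cdot>\<^sub>v u + x $ 1 \<cdot>\<^sub>v v = y $ 0 \<cdot>\<^sub>v u + y $ 1 \<cdot>\<^sub>v v"
    using xy mult_mat_of_cols_2[OF u v] by simp
  then have coord: "(x $ 0 \<cdot>\<^sub>v u + x $ 1 \<cdot>\<^sub>v v) $ j = (y $ 0 \<cdot>\<^sub>v u + y $ 1 \<cdot>\<^sub>v v) $ j" for j by simp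
  have rel: "a * u $ j + b * v $ j = 0" if "j < n" for j
  proof -
    have "x $ 0 * u $ j + x $ 1 * v $ j = y $ 0 * u $ j + y $ 1 * v $ j"
      using coord[of j] that u v by simp
    then show ?thesis unfolding a_def b_def by (simp add: algebra_simps)
  qed
  show thesis
  proof (cases "a = 0")
    case True
    then have "v = 0 \<cdot>\<^sub>v u" using ab rel u v by (intro eq_vecI) auto
    then show thesis using that[of u 1 0] u by simp
  next
    case False
    have "u = (- b / a) \<cdot>\<^sub>v v"
      using rel u v False by (intro eq_vecI) (auto simp: field_simps eq_neg_iff_add_eq_0)
    then show thesis using that[of v "- b / a" 1] v by simp
  qed
qed

lemma PLift_eq_codewords:
  assumes m: "m \<ge> 1" and k: "1 \<le> k" "k \<le> CARD('a) - 1"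
  shows "(PLift m k :: ('a::{field,finite} vec set \<Rightarrow> 'a) set) = codeword m ` Collect (lift_hom (m + 1) k)"
proof (intro equalityI subsetI)
  define v where "v = k + (m - 1) * (CARD('a) - 1)"
  \<comment> \<open>Both exponents are positive and congruent modulo q - 1, so a form of degree v
    scales like one of degree k, even for c = 0.\<close>
  have pow: "c ^ v = c ^ k" for c :: 'a
    using k by (intro finite_field_power_mod_eq) (auto simp: v_def)
  fix c :: "'a vec set \<Rightarrow> 'a"
  assume "c \<in> PLift m k"
  then obtain f where f: "f \<in> hom_polys (m + 1) v" and c: "c = ev_proj m f"
    and L: "\<And>L. L \<in> emb_proj m \<Longrightarrow> ev_proj 1 (comp_proj f L) \<in> PRS k"
    unfolding PLift_def v_def by blast
  have fp: "f \<in> polys (m + 1)" using f by (simp add: hom_polys_def)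
  have scale: "eval_mpoly f (a \<cdot>\<^sub>v x) = a ^ k * eval_mpoly f x" if "x \<in> carrier_vec (m + 1)" for a x
    using eval_mpoly_smult_hom[OF f that] pow by simp
  have "lift_hom (m + 1) k (eval_mpoly f)"
    unfolding lift_hom_def
  proof (intro ballI)
    fix u w :: "'a vec" assume u: "u \<in> carrier_vec (m + 1)" and w: "w \<in> carrier_vec (m + 1)"
    define M where "M = mat_of_cols (m + 1) [u, w]"
    note M = mult_mat_of_cols_2[OF u w, folded M_def]
    show "hom2 k (\<lambda>s t. eval_mpoly f (s \<cdot>\<^sub>v u + t \<cdot>\<^sub>v w))"
    proof (cases "inj_on (\<lambda>x. M *\<^sub>v x) (carrier_vec 2)")
      case True
      then have "M \<in> emb_proj m" using M(1) by (simp add: emb_proj_def)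
      then obtain g where g: "g \<in> hom_polys 2 k" "ev_proj 1 (comp_proj f M) = ev_proj 1 g"
        using L unfolding PRS_def by blast
      obtain F where F: "hom2 k F" "\<And>x. eval_mpoly g x = F (x $ 0) (x $ 1)"
        using hom_poly_imp_hom2[OF g(1)] by blast
      have norm: "eval_mpoly f (M *\<^sub>v y) = eval_mpoly g y" if y: "normalized 1 y" for y
      proof -
        have "eval_mpoly (comp_proj f M) y = eval_mpoly g y"
          using g(2) y unfolding ev_proj_eq_codeword codeword_eq_iff by blast
        then show ?thesis using eval_comp_proj[OF fp M(1), of y] y by (simp add: normalized_def numeral_2_eq_2)
      qed
      \<comment> \<open>Equality of codewords concerns normalized vectors only. Both sides scale by
        a^k, which extends it to the whole plane.\<close>
      have all: "eval_mpoly f (M *\<^sub>v x) = eval_mpoly g x" if x: "x \<in> carrier_vec 2" for x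
      proof -
        obtain a y where y: "normalized 1 y" "x = a \<cdot>\<^sub>v y"
          by (rule vec_normalize[of x 1]) (use x in \<open>simp_all add: numeral_2_eq_2\<close>)
        have y2: "y \<in> carrier_vec 2" using y by (simp add: normalized_def numeral_2_eq_2)
        have "M *\<^sub>v x = a \<cdot>\<^sub>v (M *\<^sub>v y)" unfolding y(2) using M(1) y2 by (rule mult_mat_vec)
        then have "eval_mpoly f (M *\<^sub>v x) = a ^ k * eval_mpoly f (M *\<^sub>v y)"
          using scale M(1) y2 by (metis mult_mat_vec_carrier)
        also have "\<dots> = eval_mpoly g x"
          unfolding norm[OF y(1)] y(2) by (rule eval_mpoly_smult_hom[OF g(1) y2, symmetric])
        finally show ?thesis .
      qed
      have "eval_mpoly f (s \<cdot>\<^sub>v u + t \<cdot>\<^sub>v w) = F s t" for s t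
      proof -
        define x where "x = vec 2 (\<lambda>i. if i = 0 then s else t)"
        have x: "x \<in> carrier_vec 2" "x $ 0 = s" "x $ 1 = t" by (auto simp: x_def)
        then show ?thesis using all[OF x(1)] M(2)[OF x(1)] F(2)[of x] by simp
      qed
      then show ?thesis using F(1) by simp
    next
      case False
      \<comment> \<open>Degenerate planes are not covered by embeddings. All their vectors are
        multiples of one z, so scaling alone yields the k-th power of a linear form times a
        constant.\<close>
      then obtain z \<alpha> \<beta> where z: "z \<in> carrier_vec (m + 1)" "u = \<alpha> \<cdot>\<^sub>v z" "w = \<beta> \<cdot>\<^sub>v z"
        unfolding M_def by (rule not_inj_imp_proportional[OF u w])
      have "s \<cdot>\<^sub>v u + t \<cdot>\<^sub>v w = (s * \<alpha> + t * \<beta>) \<cdot>\<^sub>v z" for s t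
        unfolding z(2,3) by (simp add: smult_smult_assoc add_smult_distrib_vec)
      then show ?thesis using hom2_linear_power scale[OF z(1)] by (simp add: hom2_linear_power)
    qed
  qed
  then show "c \<in> codeword m ` Collect (lift_hom (m + 1) k)"
    unfolding c ev_proj_eq_codeword by blast
next
  fix c :: "'a vec set \<Rightarrow> 'a"
  assume "c \<in> codeword m ` Collect (lift_hom (m + 1) k)"
  then obtain g where g: "lift_hom (m + 1) k g" and c: "c = codeword m g" by blast
  obtain f where f: "f \<in> hom_polys (m + 1) (k + (m - 1) * (CARD('a) - 1))"
    and fg: "\<And>x. x \<in> carrier_vec (m + 1) \<Longrightarrow> eval_mpoly f x = g x"
    using lift_hom_imp_hom_poly[OF g m k] by blast
  have fp: "f \<in> polys (m + 1)" using f by (simp add: hom_polys_def)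
  have "c = ev_proj m f" unfolding c ev_proj_eq_codeword codeword_eq_iff
    using fg by (auto simp: normalized_def)
  moreover have "ev_proj 1 (comp_proj f L) \<in> PRS k" if "L \<in> emb_proj m" for L
  proof -
    have L: "L \<in> carrier_mat (m + 1) 2" using that by (simp add: emb_proj_def)
    have cols: "col L 0 \<in> carrier_vec (m + 1)" "col L 1 \<in> carrier_vec (m + 1)" using L by (auto intro!: carrier_vecI)
    then have "hom2 k (\<lambda>s t. g (s \<cdot>\<^sub>v col L 0 + t \<cdot>\<^sub>v col L 1))"
      using g unfolding lift_hom_def by blast
    then obtain h where h: "h \<in> hom_polys 2 k"
      "\<And>x. eval_mpoly h x = g (x $ 0 \<cdot>\<^sub>v col L 0 + x $ 1 \<cdot>\<^sub>v col L 1)"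
      using hom2_imp_hom_poly by blast
    have "eval_mpoly (comp_proj f L) x = eval_mpoly h x" if "normalized 1 x" for x
    proof -
      have x: "x \<in> carrier_vec 2" using that by (simp add: normalized_def numeral_2_eq_2)
      show ?thesis using eval_comp_proj[OF fp L x] fg mult_mat_vec_2[OF L x] h(2)[of x] cols by simp
    qed
    then have "ev_proj 1 (comp_proj f L) = ev_proj 1 h"
      unfolding ev_proj_eq_codeword codeword_eq_iff by blast
    then show ?thesis unfolding PRS_def using h(1) by blast
  qed
  ultimately show "c \<in> PLift m k" unfolding PLift_def using f by blast
qed

section \<open>Affine words and lines\<close>

definition aff_word :: "nat \<Rightarrow> ('a::field vec \<Rightarrow> 'a) \<Rightarrow> 'a vec \<Rightarrow> 'a" where
  "aff_word n h = (\<lambda>x. if x \<in> carrier_vec n then h x else 0)"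

text \<open>The deleted row is taken to be the form S. It recovers the first coordinate, and a
  nonzero entry of b then recovers the second.\<close>

lemma emb_aff_nonzero_direction:
  fixes a b :: "'a::field vec"
  assumes a: "a \<in> carrier_vec n" and b: "b \<in> carrier_vec n" "b \<noteq> 0\<^sub>v n"
  shows "mat_of_cols n [a, b] \<in> emb_aff n"
proof -
  define L where "L = mat (n + 1) 2 (\<lambda>(i, j). if i = 0 then (if j = 0 then 1 else 0)
     else (if j = 0 then a else b) $ (i - 1))"
  have L: "L \<in> carrier_mat (n + 1) 2" by (simp add: L_def)
  have inj: "inj_on (\<lambda>x. L *\<^sub>v x) (carrier_vec 2)"
  proof (rule inj_onI)
    fix x y :: "'a vec" assume x: "x \<in> carrier_vec 2" and y: "y \<in> carrier_vec 2" and eq: "L *\<^sub>v x = L *\<^sub>v y"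
    have val: "(L *\<^sub>v z) $ i = L $$ (i, 0) * z $ 0 + L $$ (i, 1) * z $ 1"
      if "i < n + 1" "z \<in> carrier_vec 2" for i z
      using index_mult_mat_vec_2[OF L that(2,1)] .
    have L0: "L $$ (0, 0) = 1" "L $$ (0, 1) = 0" by (simp_all add: L_def)
    have x0: "x $ 0 = y $ 0" using val[OF _ x, of 0] val[OF _ y, of 0] eq by (simp add: L0[simplified])
    obtain i where i: "i < n" "b $ i \<noteq> 0" using nonzero_vec_index[OF b] .
    have Li: "L $$ (Suc i, 0) = a $ i" "L $$ (Suc i, 1) = b $ i" using i(1) by (simp_all add: L_def)
    have "a $ i * x $ 0 + b $ i * x $ 1 = a $ i * y $ 0 + b $ i * y $ 1"
      using val[OF _ x, of "Suc i"] val[OF _ y, of "Suc i"] eq i(1) by (simp add: Li[simplified])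
    then have "x $ 1 = y $ 1" using x0 i by simp
    then show "x = y" using x0 x y by (intro eq_vecI) (auto simp: less_2_cases_iff)
  qed
  have "row L (i + 1) = row (mat_of_cols n [a, b]) i" if "i < n" for i
  proof (rule eq_vecI)
    fix j assume "j < dim_vec (row (mat_of_cols n [a, b]) i)"
    then have "j = 0 \<or> j = 1" by (auto simp: mat_of_cols_def)
    then show "row L (i + 1) $ j = row (mat_of_cols n [a, b]) i $ j"
      using that by (auto simp: L_def mat_of_cols_def)
  qed (simp add: L_def mat_of_cols_def)
  then show ?thesis unfolding emb_aff_def emb_proj_def using L inj
    by (auto simp: numeral_2_eq_2 mat_of_cols_def)
qed

lemma Lift_eq_aff_words:
  "(Lift n d :: ('a::{field,finite} vec \<Rightarrow> 'a) set) = aff_word n ` Collect (lift_aff n d)"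
proof (intro equalityI subsetI)
  fix c :: "'a vec \<Rightarrow> 'a"
  assume "c \<in> Lift n d"
  then obtain f where f: "f \<in> polys n" and c: "c = ev_aff n f"
    and L: "\<And>L. L \<in> emb_aff n \<Longrightarrow> poly (comp_aff f L) \<in> RS d"
    unfolding Lift_def by blast
  have "lift_aff n d (eval_mpoly f)" unfolding lift_aff_def
  proof (intro ballI)
    fix a b :: "'a vec" assume a: "a \<in> carrier_vec n" and b: "b \<in> carrier_vec n"
    show "\<exists>p. Polynomial.degree p \<le> d \<and> (\<forall>t. eval_mpoly f (a + t \<cdot>\<^sub>v b) = poly p t)"
    proof (cases "b = 0\<^sub>v n")
      case True
      have "a + t \<cdot>\<^sub>v b = a" for t using a True by (intro eq_vecI) auto
      then show ?thesis by (intro exI[of _ "[:eval_mpoly f a:]"]) simp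
    next
      case False
      define M where "M = mat_of_cols n [a, b]"
      have M: "M \<in> emb_aff n" unfolding M_def by (rule emb_aff_nonzero_direction[OF a b False])
      then have Mc: "M \<in> carrier_mat n 2" unfolding emb_aff_def by blast
      obtain p where p: "poly (comp_aff f M) = poly p" "Polynomial.degree p \<le> d"
        using L[OF M] unfolding RS_def by blast
      have "col M 0 = a" "col M 1 = b" unfolding M_def using a b by auto
      then have "eval_mpoly f (a + t \<cdot>\<^sub>v b) = poly p t" for t
        using poly_comp_aff[OF f Mc, of t] p(1) by simp
      then show ?thesis using p(2) by blast
    qed
  qed
  moreover have "c = aff_word n (eval_mpoly f)" by (simp add: c ev_aff_def aff_word_def)
  ultimately show "c \<in> aff_word n ` Collect (lift_aff n d)" by blast
next
  fix c :: "'a vec \<Rightarrow> 'a"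
  assume "c \<in> aff_word n ` Collect (lift_aff n d)"
  then obtain h where h: "lift_aff n d h" and c: "c = aff_word n h" by blast
  obtain f where f: "f \<in> polys n" "\<And>x. x \<in> carrier_vec n \<Longrightarrow> eval_mpoly f x = h x"
    using function_imp_poly[of n h] by blast
  have "poly (comp_aff f L) \<in> RS d" if "L \<in> emb_aff n" for L
  proof -
    have L: "L \<in> carrier_mat n 2" using that unfolding emb_aff_def by blast
    have cols: "col L 0 \<in> carrier_vec n" "col L 1 \<in> carrier_vec n" using L by (auto intro!: carrier_vecI)
    obtain p where p: "Polynomial.degree p \<le> d" "\<And>t. h (col L 0 + t \<cdot>\<^sub>v col L 1) = poly p t"
      using h cols unfolding lift_aff_def by blast
    have "poly (comp_aff f L) = poly p"
      using poly_comp_aff[OF f(1) L] f(2) cols p(2) by (intro ext) simp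
    then show ?thesis unfolding RS_def using p(1) by blast
  qed
  moreover have "c = ev_aff n f" using f(2) by (auto simp: c ev_aff_def aff_word_def)
  ultimately show "c \<in> Lift n d" unfolding Lift_def using f(1) by blast
qed

section \<open>Cyclicity of the affine codes\<close>

text \<open>Coordinates with respect to a basis identify C with all functions from the basis to the
  field. This converts dimensions into cardinalities.\<close>

lemma card_subspace:
  fixes C :: "('x \<Rightarrow> 'a::{field,finite}) set"
  assumes C: "code.subspace C" "finite C"
  shows "card C = CARD('a) ^ code.dim C"
proof -
  obtain B where B: "B \<subseteq> C" "code.independent B" "C \<subseteq> code.span B" "card B = code.dim C"
    by (rule code.basis_exists)
  have finB: "finite B" using B(1) C(2) by (rule finite_subset)
  have span: "code.span B = C" using B C(1) code.span_minimal by blast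
  define f where "f u = (\<Sum>v\<in>B. fun_scale (u v) v)" for u
  have "bij_betw f (B \<rightarrow>\<^sub>E UNIV) C"
  proof (rule bij_betw_imageI)
    show "inj_on f (B \<rightarrow>\<^sub>E UNIV)"
    proof (rule inj_onI)
      fix u w assume u: "u \<in> B \<rightarrow>\<^sub>E (UNIV :: 'a set)" and w: "w \<in> B \<rightarrow>\<^sub>E UNIV" and eq: "f u = f w"
      have "(\<Sum>v\<in>B. fun_scale (u v - w v) v) = 0"
        using eq by (simp add: f_def code.scale_left_diff_distrib sum_subtractf)
      then have "u v - w v = 0" if "v \<in> B" for v
        using code.independentD[OF B(2) finB subset_refl, of "\<lambda>v. u v - w v"] that by blast
      then show "u = w" using u w by (intro PiE_ext) auto
    qed
    have "f u \<in> f ` (B \<rightarrow>\<^sub>E UNIV)" for u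
    proof -
      have "f u = f (restrict u B)" unfolding f_def by (intro sum.cong) auto
      then show ?thesis by auto
    qed
    then have "f ` (B \<rightarrow>\<^sub>E UNIV) = range f" by auto
    also have "\<dots> = C" using code.span_finite[OF finB] span by (simp add: f_def)
    finally show "f ` (B \<rightarrow>\<^sub>E UNIV) = C" .
  qed
  then show ?thesis using bij_betw_same_card B(4) finB by (fastforce simp: card_PiE)
qed

text \<open>The subspaces of sequences vanishing at the first \<open>n\<close> places decrease strictly until they become
  constant, and once constant they are trivial by shift invariance.\<close>

lemma shift_invariant_zero:
  fixes V :: "(nat \<Rightarrow> 'a::{field,finite}) set"
  assumes add: "\<And>s t. s \<in> V \<Longrightarrow> t \<in> V \<Longrightarrow> (\<lambda>n. s n + t n) \<in> V"
    and scale: "\<And>c s. s \<in> V \<Longrightarrow> (\<lambda>n. c * s n) \<in> V"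
    and shift: "\<And>s. s \<in> V \<Longrightarrow> (\<lambda>n. s (Suc n)) \<in> V"
    and fin: "finite V" and card: "card V \<le> CARD('a) ^ d"
    and t: "t \<in> V" "\<And>n. n < d \<Longrightarrow> t n = 0"
  shows "t n = 0"
proof (rule ccontr)
  assume tn: "t n \<noteq> 0"
  define U where "U n = {s \<in> V. \<forall>i<n. s i = 0}" for n
  have finU: "finite (U n)" for n using fin by (simp add: U_def)
  have zero: "(\<lambda>_. 0) \<in> V" using scale[OF t(1), of 0] by simp
  have stable: "U (a + b) = U a" if eq: "U a = U (Suc a)" for a b
  proof (induction b)
    case (Suc b)
    have "U (Suc a) \<subseteq> U (Suc a + b)" for b
    proof (induction b)
      case (Suc b)
      have "s \<in> U (Suc (Suc a + b))" if s: "s \<in> U (Suc a + b)" for s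
      proof -
        \<comment> \<open>The shift of s vanishes at the first a + b places, so it lies in
          \<open>U a\<close>, which is \<open>U (Suc a)\<close>. By induction it vanishes at
          \<open>Suc a + b\<close> places, which gives s one more zero.\<close>
        have "(\<lambda>n. s (Suc n)) \<in> U a" using s shift by (auto simp: U_def)
        then have "(\<lambda>n. s (Suc n)) \<in> U (Suc a + b)" using eq Suc by blast
        then have "s (Suc i) = 0" if "i < Suc a + b" for i using that by (auto simp: U_def)
        then show ?thesis using s by (auto simp: U_def less_Suc_eq_0_disj)
      qed
      then show ?case using Suc by auto
    qed simp
    moreover have "U (a + Suc b) \<subseteq> U a" by (auto simp: U_def)
    ultimately show ?case using eq by fastforce
  qed simp
  \<comment> \<open>Up to index d every \<open>U a\<close> contains t. Were the chain constant from
    there on, t would vanish at n as well.\<close>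
  have strict: "\<exists>c\<in>U a. c a \<noteq> 0" if a: "a \<le> d" for a
  proof (rule ccontr)
    assume "\<not> ?thesis"
    then have "U a = U (Suc a)" by (auto simp: U_def less_Suc_eq)
    from stable[OF this, of "Suc n"] have "U a \<subseteq> U (a + Suc n)" by simp
    moreover have "t \<in> U a" using t a by (auto simp: U_def)
    ultimately have "t \<in> U (a + Suc n)" by blast
    then show False using tn by (auto simp: U_def)
  qed
  \<comment> \<open>Since c is nonzero at place a, its q multiples lead to q disjoint translates of
    \<open>U (Suc a)\<close> inside \<open>U a\<close>.\<close>
  have step: "CARD('a) * card (U (Suc a)) \<le> card (U a)" if a: "a \<le> d" for a
  proof -
    obtain c where c: "c \<in> U a" "c a \<noteq> 0" using strict[OF a] by blast
    define F where "F = (\<lambda>(l :: 'a, s). (\<lambda>n. l * c n + s n))"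
    have "inj_on F (UNIV \<times> U (Suc a))"
    proof (rule inj_onI, clarify)
      fix l s l' s' assume s: "s \<in> U (Suc a)" "s' \<in> U (Suc a)" and eq: "F (l, s) = F (l', s')"
      have "l * c n + s n = l' * c n + s' n" for n using fun_cong[OF eq, of n] by (simp add: F_def)
      note eq = this
      have "l = l'" using eq[of a] s c(2) by (simp add: U_def)
      then show "l = l' \<and> s = s'" using eq by auto
    qed
    moreover have "F ` (UNIV \<times> U (Suc a)) \<subseteq> U a"
      using c(1) add scale by (auto simp: F_def U_def)
    ultimately have "card (UNIV \<times> U (Suc a) :: ('a \<times> _) set) \<le> card (U a)"
      using finU card_inj_on_le by blast
    then show ?thesis by (simp add: card_cartesian_product)
  qed
  \<comment> \<open>The d + 1 strict steps down to \<open>U (Suc d)\<close>, which still contains 0,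
    force at least q^(d + 1) elements in V.\<close>
  have "CARD('a) ^ a \<le> card (U (Suc d - a))" if "a \<le> Suc d" for a
    using that
  proof (induction a)
    case 0
    have "(\<lambda>_. 0) \<in> U (Suc d)" using zero by (simp add: U_def)
    then have "card (U (Suc d)) > 0" using finU card_gt_0_iff by blast
    then show ?case by simp
  next
    case (Suc a)
    have "CARD('a) ^ Suc a \<le> CARD('a) * card (U (Suc d - a))" using Suc by simp
    also have "Suc d - a = Suc (d - a)" using Suc.prems by simp
    also have "CARD('a) * card (U (Suc (d - a))) \<le> card (U (d - a))" by (rule step) simp
    finally show ?case by simp
  qed
  from this[of "Suc d"] have "CARD('a) ^ Suc d \<le> card V" by (simp add: U_def)
  moreover have "CARD('a) ^ d < CARD('a) ^ Suc d"
    using finite_field_card_gt_1[where 'a = 'a] by simp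
  ultimately show False using card by linarith
qed

section \<open>Linear structure and symmetries of the affine code\<close>

lemma lift_aff_add:
  assumes "lift_aff n d g" "lift_aff n d h"
  shows "lift_aff n d (\<lambda>x. g x + h x)"
  unfolding lift_aff_def
proof (intro ballI)
  fix a b :: "'a vec" assume ab: "a \<in> carrier_vec n" "b \<in> carrier_vec n"
  obtain p where p: "Polynomial.degree p \<le> d" "\<And>t. g (a + t \<cdot>\<^sub>v b) = poly p t"
    using assms(1) ab unfolding lift_aff_def by blast
  obtain r where r: "Polynomial.degree r \<le> d" "\<And>t. h (a + t \<cdot>\<^sub>v b) = poly r t"
    using assms(2) ab unfolding lift_aff_def by blast
  show "\<exists>p. Polynomial.degree p \<le> d \<and> (\<forall>t. g (a + t \<cdot>\<^sub>v b) + h (a + t \<cdot>\<^sub>v b) = poly p t)"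
    using p r by (intro exI[of _ "p + r"]) (simp add: degree_add_le)
qed

lemma lift_aff_cmult:
  assumes "lift_aff n d h"
  shows "lift_aff n d (\<lambda>x. c * h x)"
  unfolding lift_aff_def
proof (intro ballI)
  fix a b :: "'a vec" assume ab: "a \<in> carrier_vec n" "b \<in> carrier_vec n"
  obtain p where p: "Polynomial.degree p \<le> d" "\<And>t. h (a + t \<cdot>\<^sub>v b) = poly p t"
    using assms ab unfolding lift_aff_def by blast
  show "\<exists>p. Polynomial.degree p \<le> d \<and> (\<forall>t. c * h (a + t \<cdot>\<^sub>v b) = poly p t)"
    using p by (intro exI[of _ "Polynomial.smult c p"]) (auto intro: order_trans[OF degree_smult_le])
qed

lemma lift_aff_const: "lift_aff n d (\<lambda>_. c)"
  unfolding lift_aff_def by (intro ballI exI[of _ "[:c:]"]) simp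

lemma lift_aff_compose_linear:
  assumes h: "lift_aff n d h"
    and T: "\<And>x. x \<in> carrier_vec n \<Longrightarrow> T x \<in> carrier_vec n"
      "\<And>a b t. a \<in> carrier_vec n \<Longrightarrow> b \<in> carrier_vec n \<Longrightarrow> T (a + t \<cdot>\<^sub>v b) = T a + t \<cdot>\<^sub>v T b"
  shows "lift_aff n d (\<lambda>x. h (T x))"
  unfolding lift_aff_def
proof (intro ballI)
  fix a b :: "'a vec" assume ab: "a \<in> carrier_vec n" "b \<in> carrier_vec n"
  obtain p where p: "Polynomial.degree p \<le> d" "\<And>t. h (T a + t \<cdot>\<^sub>v T b) = poly p t"
    using h T(1) ab unfolding lift_aff_def by blast
  then show "\<exists>p. Polynomial.degree p \<le> d \<and> (\<forall>t. h (T (a + t \<cdot>\<^sub>v b)) = poly p t)"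
    using T(2) ab by (intro exI[of _ p]) simp
qed

text \<open>On a line through the origin the q - 1 other points are roots of a polynomial of degree
  below q - 1, which is therefore 0.\<close>

lemma lift_aff_zero_if_zero_on_nonzero:
  fixes h :: "'a::{field,finite} vec \<Rightarrow> 'a"
  assumes h: "lift_aff n d h" and n: "n \<ge> 1" and d: "d < CARD('a) - 1"
    and zero: "\<And>x. x \<in> carrier_vec n \<Longrightarrow> x \<noteq> 0\<^sub>v n \<Longrightarrow> h x = 0"
  shows "h (0\<^sub>v n) = 0"
proof -
  obtain p where p: "Polynomial.degree p \<le> d" "\<And>t. h (0\<^sub>v n + t \<cdot>\<^sub>v unit_vec n 0) = poly p t"
    using h unfolding lift_aff_def by (meson unit_vec_carrier zero_carrier_vec)
  have p0: "poly p 0 = h (0\<^sub>v n)"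
  proof -
    have "0\<^sub>v n + 0 \<cdot>\<^sub>v unit_vec n 0 = (0\<^sub>v n :: 'a vec)" by (intro eq_vecI) auto
    then show ?thesis using p(2)[of 0] by simp
  qed
  have pt: "poly p t = 0" if t: "t \<noteq> 0" for t
  proof -
    let ?x = "0\<^sub>v n + t \<cdot>\<^sub>v unit_vec n 0"
    have "?x $ 0 = t" using n by simp
    moreover have "0\<^sub>v n $ 0 = (0 :: 'a)" using n by simp
    ultimately have "?x \<noteq> 0\<^sub>v n" using t by metis
    moreover have "?x \<in> carrier_vec n" by simp
    ultimately have "h ?x = 0" by (rule zero[rotated])
    then show ?thesis unfolding p(2) .
  qed
  have "p = 0"
  proof (rule ccontr)
    assume "p \<noteq> 0"
    have "CARD('a) - 1 = card (- {0::'a})" by (simp add: Compl_eq_Diff_UNIV card_Diff_singleton)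
    also have "\<dots> \<le> card {x. poly p x = 0}" using pt by (intro card_mono) auto
    also have "\<dots> \<le> Polynomial.degree p" using \<open>p \<noteq> 0\<close> by (rule card_poly_roots_bound)
    finally show False using p(1) d by simp
  qed
  then show ?thesis using p0 by simp
qed

lemma aff_word_apply: "x \<in> carrier_vec n \<Longrightarrow> aff_word n h x = h x"
  by (simp add: aff_word_def)

lemma subspace_Lift: "code.subspace (Lift n d :: ('a::{field,finite} vec \<Rightarrow> 'a) set)"
proof (rule code.subspaceI)
  have "(0 :: 'a vec \<Rightarrow> 'a) = aff_word n (\<lambda>_. 0)" by (auto simp: aff_word_def)
  then show "0 \<in> (Lift n d :: ('a vec \<Rightarrow> 'a) set)"
    unfolding Lift_eq_aff_words using lift_aff_const by blast
next
  fix x y :: "'a vec \<Rightarrow> 'a" assume "x \<in> Lift n d" "y \<in> Lift n d"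
  then obtain g h where gh: "lift_aff n d g" "lift_aff n d h" "x = aff_word n g" "y = aff_word n h"
    unfolding Lift_eq_aff_words by blast
  have "x + y = aff_word n (\<lambda>z. g z + h z)" unfolding gh by (auto simp: aff_word_def)
  then show "x + y \<in> Lift n d"
    unfolding Lift_eq_aff_words using lift_aff_add[OF gh(1,2)] by blast
next
  fix c :: 'a and x :: "'a vec \<Rightarrow> 'a" assume "x \<in> Lift n d"
  then obtain h where h: "lift_aff n d h" "x = aff_word n h"
    unfolding Lift_eq_aff_words by blast
  have "fun_scale c x = aff_word n (\<lambda>z. c * h z)" unfolding h by (auto simp: aff_word_def fun_scale_def)
  then show "fun_scale c x \<in> Lift n d"
    unfolding Lift_eq_aff_words using lift_aff_cmult[OF h(1)] by blast
qed

text \<open>The type of vectors comprises all lengths and is infinite; finiteness rests on words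
  being 0 outside \<open>carrier_vec n\<close>.\<close>

lemma finite_Lift: "finite (Lift n d :: ('a::{field,finite} vec \<Rightarrow> 'a) set)"
proof (rule finite_subset)
  let ?F = "carrier_vec n \<rightarrow>\<^sub>E (UNIV :: 'a set)"
  show "finite (aff_word n ` ?F)" by (intro finite_imageI finite_PiE finite_carrier_vec) auto
  show "Lift n d \<subseteq> aff_word n ` ?F"
  proof
    fix c :: "'a vec \<Rightarrow> 'a" assume "c \<in> Lift n d"
    then obtain h where "c = aff_word n h" unfolding Lift_eq_aff_words by blast
    then have "c = aff_word n (restrict h (carrier_vec n))" by (auto simp: aff_word_def)
    then show "c \<in> aff_word n ` ?F" by auto
  qed
qed

text \<open>Positions start at exponent 1. Writing x as (x / w) * w, with x / w a power of exponent
  at least 0, gives a positive exponent.\<close>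

lemma primitive_powers:
  assumes K: "field K" "finite (carrier K)" and w: "primitive_element K w"
    and x: "x \<in> carrier K" "x \<noteq> \<zero>\<^bsub>K\<^esub>"
  shows "\<exists>n::nat. x = w [^]\<^bsub>K\<^esub> Suc n"
proof -
  interpret field K by fact
  interpret M: group "mult_of K" by (rule field_mult_group)
  have wc: "w \<in> carrier (mult_of K)" and gen: "generate (mult_of K) {w} = carrier (mult_of K)"
    using w by (auto simp: primitive_element_def)
  have fin: "finite (carrier (mult_of K))" using K(2) by (rule finite_mult_of)
  have xc: "x \<in> carrier (mult_of K)" using x by simp
  let ?y = "x \<otimes>\<^bsub>mult_of K\<^esub> inv\<^bsub>mult_of K\<^esub> w"
  have "?y \<in> generate (mult_of K) {w}" unfolding gen by (rule M.m_closed[OF xc M.inv_closed[OF wc]])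
  then obtain n :: nat where n: "?y = w [^]\<^bsub>mult_of K\<^esub> n"
    using M.generate_pow_on_finite_carrier[OF fin wc] by auto
  have "x = ?y \<otimes>\<^bsub>mult_of K\<^esub> w" using xc wc by (simp only: M.m_assoc M.inv_closed M.l_inv M.r_one)
  also have "\<dots> = w [^]\<^bsub>mult_of K\<^esub> Suc n" unfolding n by simp
  finally show ?thesis unfolding nat_pow_mult_of by blast
qed

text \<open>The sequences of values at w, w^2, ... form a shift invariant space with at most q^dim
  elements, so dim initial zeros make the whole sequence 0. Powers of w exhaust the nonzero vectors,
  and the origin follows from the degree bound.\<close>

lemma linear_iso_zero_on_powers:
  fixes h :: "'a::{field,finite} vec \<Rightarrow> 'a" and \<psi> :: "'b \<Rightarrow> 'a vec"
  assumes K: "ext_field i K e" and w: "primitive_element K w" and \<psi>: "linear_iso i K e \<psi>"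
    and i: "i \<ge> 1" and d: "d < CARD('a) - 1"
    and h: "lift_aff i d h"
    and zero: "\<And>n. n \<in> {1..code.dim (Lift i d :: ('a vec \<Rightarrow> 'a) set)} \<Longrightarrow> h (\<psi> (w [^]\<^bsub>K\<^esub> n)) = 0"
    and x: "x \<in> carrier_vec i"
  shows "h x = 0"
proof -
  have fK: "field K" and cK: "card (carrier K) = CARD('a) ^ i" and e: "e \<in> Ring.ring_hom class_ring K"
    using K by (auto simp: ext_field_def)
  interpret field K by fact
  have finK: "finite (carrier K)" using cK by (intro card_ge_0_finite) simp
  have wc: "w \<in> carrier K" using w by (simp add: primitive_element_def)
  have ec: "e c \<in> carrier K" for c using ring_hom_closed[OF e, of c] by (simp add: class_ring_simps)
  have bij: "bij_betw \<psi> (carrier K) (carrier_vec i)"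
    and addp: "\<And>x y. x \<in> carrier K \<Longrightarrow> y \<in> carrier K \<Longrightarrow> \<psi> (x \<oplus>\<^bsub>K\<^esub> y) = \<psi> x + \<psi> y"
    and smp: "\<And>c x. x \<in> carrier K \<Longrightarrow> \<psi> (e c \<otimes>\<^bsub>K\<^esub> x) = c \<cdot>\<^sub>v \<psi> x"
    using \<psi> by (auto simp: linear_iso_def)
  have pc: "\<psi> x \<in> carrier_vec i" if "x \<in> carrier K" for x
    using bij that by (auto dest: bij_betwE)
  have psi0: "\<psi> \<zero>\<^bsub>K\<^esub> = 0\<^sub>v i"
  proof -
    have "\<psi> \<zero>\<^bsub>K\<^esub> = \<psi> \<zero>\<^bsub>K\<^esub> + \<psi> \<zero>\<^bsub>K\<^esub>" using addp[of "\<zero>\<^bsub>K\<^esub>" "\<zero>\<^bsub>K\<^esub>"] by simp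
    then have "\<psi> \<zero>\<^bsub>K\<^esub> + 0\<^sub>v i = \<psi> \<zero>\<^bsub>K\<^esub> + \<psi> \<zero>\<^bsub>K\<^esub>" using pc[of "\<zero>\<^bsub>K\<^esub>"] by simp
    then have "\<psi> \<zero>\<^bsub>K\<^esub> $ j + 0 = \<psi> \<zero>\<^bsub>K\<^esub> $ j + \<psi> \<zero>\<^bsub>K\<^esub> $ j" if "j < i" for j
      using pc[of "\<zero>\<^bsub>K\<^esub>"] that by (metis carrier_vecD index_add_vec(1) index_zero_vec zero_closed)
    then show ?thesis using pc[of "\<zero>\<^bsub>K\<^esub>"] by (intro eq_vecI) (simp_all only: add_left_cancel index_zero_vec carrier_vecD zero_closed)
  qed
  define inv\<psi> where "inv\<psi> = inv_into (carrier K) \<psi>"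
  have ic: "inv\<psi> y \<in> carrier K" if "y \<in> carrier_vec i" for y
    unfolding inv\<psi>_def using bij_betw_imp_surj_on[OF bij] that by (intro inv_into_into) simp
  have pi: "\<psi> (inv\<psi> y) = y" if "y \<in> carrier_vec i" for y
    unfolding inv\<psi>_def by (rule bij_betw_inv_into_right[OF bij that])
  have ip: "inv\<psi> (\<psi> x) = x" if "x \<in> carrier K" for x
    using bij that unfolding inv\<psi>_def by (rule bij_betw_inv_into_left)
  \<comment> \<open>Multiplication by w, carried over to vectors. It commutes with scalars from the
    base field, so it is linear, and composing a word with it shifts the sequence of values.\<close>
  define T where "T y = \<psi> (w \<otimes>\<^bsub>K\<^esub> inv\<psi> y)" for y
  have T1: "T y \<in> carrier_vec i" if "y \<in> carrier_vec i" for y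
    unfolding T_def using ic[OF that] wc by (intro pc) simp
  have T2: "T (a + t \<cdot>\<^sub>v b) = T a + t \<cdot>\<^sub>v T b" if a: "a \<in> carrier_vec i" and b: "b \<in> carrier_vec i" for a b t
  proof -
    have "\<psi> (inv\<psi> a \<oplus>\<^bsub>K\<^esub> (e t \<otimes>\<^bsub>K\<^esub> inv\<psi> b)) = a + t \<cdot>\<^sub>v b"
      using ic[OF a] ic[OF b] ec by (simp add: addp smp pi a b)
    then have "inv\<psi> (a + t \<cdot>\<^sub>v b) = inv\<psi> a \<oplus>\<^bsub>K\<^esub> (e t \<otimes>\<^bsub>K\<^esub> inv\<psi> b)"
      using ip ic[OF a] ic[OF b] ec by (metis add.m_closed m_closed)
    then have "T (a + t \<cdot>\<^sub>v b) = \<psi> ((w \<otimes>\<^bsub>K\<^esub> inv\<psi> a) \<oplus>\<^bsub>K\<^esub> (e t \<otimes>\<^bsub>K\<^esub> (w \<otimes>\<^bsub>K\<^esub> inv\<psi> b)))"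
      unfolding T_def using ic[OF a] ic[OF b] ec wc by (simp add: r_distr m_lcomm)
    also have "\<dots> = T a + t \<cdot>\<^sub>v T b"
      unfolding T_def using ic[OF a] ic[OF b] ec wc by (simp add: addp smp)
    finally show ?thesis .
  qed
  have Tpow: "T (\<psi> (w [^]\<^bsub>K\<^esub> n)) = \<psi> (w [^]\<^bsub>K\<^esub> Suc n)" for n :: nat
    unfolding T_def using wc by (simp add: ip m_comm)
  \<comment> \<open>Place n holds the exponent n + 1, so the first dim places are the exponents 1,
    ..., dim.\<close>
  define V where "V = (\<lambda>h n. h (\<psi> (w [^]\<^bsub>K\<^esub> Suc n))) ` Collect (lift_aff i d)"
  let ?L = "Lift i d :: ('a vec \<Rightarrow> 'a) set"
  have "\<psi> (w [^]\<^bsub>K\<^esub> Suc n) \<in> carrier_vec i" for n :: nat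
    using wc by (intro pc nat_pow_closed)
  then have VL: "V = (\<lambda>h n. h (\<psi> (w [^]\<^bsub>K\<^esub> Suc n))) ` ?L"
    unfolding V_def Lift_eq_aff_words image_image by (simp only: aff_word_apply)
  have finV: "finite V" unfolding VL by (intro finite_imageI finite_Lift)
  have cardV: "card V \<le> CARD('a) ^ code.dim ?L"
    unfolding VL card_subspace[OF subspace_Lift finite_Lift, symmetric]
    by (rule card_image_le[OF finite_Lift])
  have "h (\<psi> (w [^]\<^bsub>K\<^esub> Suc n)) = 0" for n
  proof (rule shift_invariant_zero[where V = V and t = "\<lambda>n. h (\<psi> (w [^]\<^bsub>K\<^esub> Suc n))"])
    fix s t assume "s \<in> V" "t \<in> V"
    then obtain f g where fg: "lift_aff i d f" "lift_aff i d g"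
      "s = (\<lambda>n. f (\<psi> (w [^]\<^bsub>K\<^esub> Suc n)))" "t = (\<lambda>n. g (\<psi> (w [^]\<^bsub>K\<^esub> Suc n)))"
      unfolding V_def by blast
    then show "(\<lambda>n. s n + t n) \<in> V"
      unfolding V_def using lift_aff_add[OF fg(1,2)] fg(3,4) by (intro image_eqI[of _ _ "\<lambda>x. f x + g x"]) auto
  next
    fix c s assume "s \<in> V"
    then obtain f where f: "lift_aff i d f" "s = (\<lambda>n. f (\<psi> (w [^]\<^bsub>K\<^esub> Suc n)))"
      unfolding V_def by blast
    then show "(\<lambda>n. c * s n) \<in> V"
      unfolding V_def using lift_aff_cmult[OF f(1)] f(2) by (intro image_eqI[of _ _ "\<lambda>x. c * f x"]) auto
  next
    fix s assume "s \<in> V"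
    then obtain f where f: "lift_aff i d f" "s = (\<lambda>n. f (\<psi> (w [^]\<^bsub>K\<^esub> Suc n)))"
      unfolding V_def by blast
    have "lift_aff i d (\<lambda>x. f (T x))" using f(1) T1 T2 by (rule lift_aff_compose_linear)
    then show "(\<lambda>n. s (Suc n)) \<in> V"
      unfolding V_def f(2) by (intro image_eqI[of _ _ "\<lambda>x. f (T x)"]) (simp_all only: Tpow mem_Collect_eq)
  next
    show "(\<lambda>n. h (\<psi> (w [^]\<^bsub>K\<^esub> Suc n))) \<in> V" unfolding V_def using h by blast
  next
    fix n assume "n < code.dim ?L"
    then show "h (\<psi> (w [^]\<^bsub>K\<^esub> Suc n)) = 0" by (intro zero) simp
  qed (rule finV cardV)+
  then have nz: "h y = 0" if y: "y \<in> carrier_vec i" "y \<noteq> 0\<^sub>v i" for y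
  proof -
    have "inv\<psi> y \<noteq> \<zero>\<^bsub>K\<^esub>" using pi[OF y(1)] y(2) psi0 by auto
    then obtain n :: nat where "inv\<psi> y = w [^]\<^bsub>K\<^esub> Suc n"
      using primitive_powers[OF fK finK w ic[OF y(1)]] by blast
    then show ?thesis using pi[OF y(1)] \<open>\<And>n. h (\<psi> (w [^]\<^bsub>K\<^esub> Suc n)) = 0\<close> by metis
  qed
  then show ?thesis using lift_aff_zero_if_zero_on_nonzero[OF h i d] x by blast
qed

lemma linear_iso_interpolate_powers:
  fixes f :: "'a::{field,finite} vec \<Rightarrow> 'a" and \<psi> :: "'b \<Rightarrow> 'a vec"
  assumes K: "ext_field i K e" and w: "primitive_element K w" and \<psi>: "linear_iso i K e \<psi>"
    and i: "i \<ge> 1" and d: "d < CARD('a) - 1"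
  defines "X \<equiv> (\<lambda>n. \<psi> (w [^]\<^bsub>K\<^esub> n)) ` {1..code.dim (Lift i d :: ('a vec \<Rightarrow> 'a) set)}"
  shows "X \<subseteq> carrier_vec i" "\<exists>h. lift_aff i d h \<and> (\<forall>x\<in>X. h x = f x)"
proof -
  let ?L = "Lift i d :: ('a vec \<Rightarrow> 'a) set"
  let ?R = "\<lambda>c. restrict c X"
  interpret field K using K by (simp add: ext_field_def)
  have wc: "w \<in> carrier K" using w by (simp add: primitive_element_def)
  show X: "X \<subseteq> carrier_vec i"
    unfolding X_def using \<psi> wc by (auto simp: linear_iso_def dest: bij_betwE)
  have inj: "inj_on ?R ?L"
  proof (rule inj_onI)
    fix c c' assume "c \<in> ?L" "c' \<in> ?L" and eq: "?R c = ?R c'"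
    then obtain g h where gh: "lift_aff i d g" "lift_aff i d h" "c = aff_word i g" "c' = aff_word i h"
      unfolding Lift_eq_aff_words by blast
    have agree: "g x = h x" if "x \<in> X" for x
      using fun_cong[OF eq, of x] that X gh(3,4) by (auto simp: aff_word_def)
    let ?h = "\<lambda>x. g x + (-1) * h x"
    have lift: "lift_aff i d ?h" using lift_aff_add[OF gh(1) lift_aff_cmult[OF gh(2), of "-1"]] .
    have "?h x = 0" if "x \<in> carrier_vec i" for x
    proof (rule linear_iso_zero_on_powers[OF K w \<psi> i d lift _ that])
      fix n assume "n \<in> {1..code.dim ?L}"
      then have "\<psi> (w [^]\<^bsub>K\<^esub> n) \<in> X" unfolding X_def by (rule imageI)
      then show "?h (\<psi> (w [^]\<^bsub>K\<^esub> n)) = 0" using agree by simp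
    qed
    then show "c = c'" unfolding gh by (auto simp: aff_word_def)
  qed
  have finX: "finite X" by (simp add: X_def)
  \<comment> \<open>\<open>X\<close> is an image of dim indices and carries at most q^dim functions.
    The injective restriction already produces q^dim of them, so it is onto.\<close>
  have "card X \<le> code.dim ?L" unfolding X_def using card_image_le[of "{1..code.dim ?L}"] by auto
  then have "CARD('a) ^ card X \<le> CARD('a) ^ code.dim ?L"
    using finite_field_card_gt_1[where 'a = 'a] by (intro power_increasing) auto
  moreover have "card (X \<rightarrow>\<^sub>E (UNIV :: 'a set)) = CARD('a) ^ card X"
    using card_PiE[OF finX, of "\<lambda>_. UNIV :: 'a set"] by simp
  moreover have "card (?R ` ?L) = CARD('a) ^ code.dim ?L"
    unfolding card_image[OF inj] by (rule card_subspace[OF subspace_Lift finite_Lift])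
  ultimately have card: "card (X \<rightarrow>\<^sub>E (UNIV :: 'a set)) \<le> card (?R ` ?L)" by simp
  have "finite (X \<rightarrow>\<^sub>E (UNIV :: 'a set))" using finX by (intro finite_PiE) auto
  moreover have "?R ` ?L \<subseteq> X \<rightarrow>\<^sub>E UNIV" by (intro image_subsetI) simp
  ultimately have onto: "?R ` ?L = X \<rightarrow>\<^sub>E UNIV" using card by (rule card_seteq)
  have "restrict f X \<in> ?R ` ?L" unfolding onto by simp
  then obtain h where h: "lift_aff i d h" "restrict f X = ?R (aff_word i h)"
    unfolding Lift_eq_aff_words by blast
  have "h x = f x" if "x \<in> X" for x
    using fun_cong[OF h(2), of x] that X by (auto simp: aff_word_def)
  then show "\<exists>h. lift_aff i d h \<and> (\<forall>x\<in>X. h x = f x)" using h(1) by blast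
qed

lemma lift_hom_add: "lift_hom n k g \<Longrightarrow> lift_hom n k h \<Longrightarrow> lift_hom n k (\<lambda>x. g x + h x)"
  unfolding lift_hom_def by (intro ballI hom2_add) auto

lemma lift_hom_cmult: "lift_hom n k g \<Longrightarrow> lift_hom n k (\<lambda>x. c * g x)"
  unfolding lift_hom_def by (intro ballI hom2_cmult) auto

lemma lift_hom_const_zero: "lift_hom n k (\<lambda>x. 0)"
  unfolding lift_hom_def by (intro ballI hom2_zero)

section \<open>Gluing along the cells\<close>

definition cell_vec :: "nat \<Rightarrow> nat \<Rightarrow> 'a::field vec \<Rightarrow> 'a vec" where
  "cell_vec m i x =
     vec (m + 1) (\<lambda>j. if j < m - i then 0 else if j = m - i then 1 else x $ (j - (m - i) - 1))"

lemma cell_pt_eq: "cell_pt m i x = proj_pt m (cell_vec m i x)"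
  by (simp add: cell_pt_def cell_vec_def)

lemma normalized_cell_vec: "normalized m (cell_vec m i x)"
  unfolding normalized_def by (auto simp: cell_vec_def intro!: exI[of _ "m - i"])

lemma cell_vec_carrier: "cell_vec m i x \<in> carrier_vec (m + 1)"
  by (simp add: cell_vec_def)

lemma cell_vec_pivot: "cell_vec m i x $ (m - i) = 1"
  by (simp add: cell_vec_def)

lemma cell_vec_below_pivot: "j < m - i \<Longrightarrow> cell_vec m i x $ j = 0"
  by (simp add: cell_vec_def)

text \<open>The pivot index m - i of the standard representative determines i, so different cells
  are disjoint.\<close>

lemma cell_pt_inj:
  assumes "cell_pt m i x = cell_pt m i' x'" "i \<le> m" "i' \<le> m"
  shows "i = i'"
proof -
  have eq: "cell_vec m i x = cell_vec m i' x'"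
    using arg_cong[OF assms(1), of std_rep]
    by (simp add: cell_pt_eq proj_pt_normalized normalized_cell_vec)
  have "\<not> m - i < m - i'" "\<not> m - i' < m - i"
    using cell_vec_pivot[of m i x] cell_vec_below_pivot[of "m - i" m i' x']
      cell_vec_pivot[of m i' x'] cell_vec_below_pivot[of "m - i'" m i x] eq by auto
  then show ?thesis using assms(2,3) by linarith
qed

definition tail_vec :: "nat \<Rightarrow> nat \<Rightarrow> 'a vec \<Rightarrow> 'a vec" where
  "tail_vec m i u = vec i (\<lambda>j. u $ (m - i + 1 + j))"

lemma tail_vec_carrier [simp]: "tail_vec m i u \<in> carrier_vec i"
  by (simp add: tail_vec_def)

lemma tail_vec_cell_vec: "i \<le> m \<Longrightarrow> x \<in> carrier_vec i \<Longrightarrow> tail_vec m i (cell_vec m i x) = x"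
  by (intro eq_vecI) (auto simp: tail_vec_def cell_vec_def)

lemma tail_vec_linear:
  assumes "i \<le> m" "u \<in> carrier_vec (m + 1)" "v \<in> carrier_vec (m + 1)"
  shows "tail_vec m i (s \<cdot>\<^sub>v u + t \<cdot>\<^sub>v v) = s \<cdot>\<^sub>v tail_vec m i u + t \<cdot>\<^sub>v tail_vec m i v"
  using assms by (intro eq_vecI) (auto simp: tail_vec_def)

text \<open>The vectors lying over the cells of dimension less than \<open>i\<close>, together with \<open>0\<close>.\<close>

definition low_vec :: "nat \<Rightarrow> nat \<Rightarrow> 'a::zero vec \<Rightarrow> bool" where
  "low_vec m i u \<longleftrightarrow> u \<in> carrier_vec (m + 1) \<and> (\<forall>j<m + 1 - i. u $ j = 0)"

lemma lift_aff_cell: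
  assumes g: "lift_hom (m + 1) k g" and k: "k \<ge> 1" and i: "i \<le> m"
    and low: "\<And>u. low_vec m i u \<Longrightarrow> g u = 0"
  shows "lift_aff i (k - 1) (\<lambda>x. g (cell_vec m i x))"
  unfolding lift_aff_def
proof (intro ballI)
  fix a b :: "'a vec" assume a: "a \<in> carrier_vec i" and b: "b \<in> carrier_vec i"
  \<comment> \<open>The direction b as a point at infinity: the pivot coordinate is 0 too, so
    \<open>v\<close> is low and moving along b in the cell adds multiples of
    \<open>v\<close>.\<close>
  define v where "v = vec (m + 1) (\<lambda>j. if j \<le> m - i then 0 else b $ (j - (m - i) - 1))"
  have v: "v \<in> carrier_vec (m + 1)" by (simp add: v_def)
  obtain p where p: "\<And>s t. g (s \<cdot>\<^sub>v cell_vec m i a + t \<cdot>\<^sub>v v) = (\<Sum>j\<le>k. p j * s ^ j * t ^ (k - j))"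
    using g v cell_vec_carrier unfolding lift_hom_def hom2_def by meson
  \<comment> \<open>Evaluating the form at s = 0, t = 1 isolates \<open>p 0\<close>, the coefficient
    of t^k, as the value of g at \<open>v\<close>.\<close>
  have "low_vec m i v" using i by (auto simp: low_vec_def v_def)
  moreover have "0 \<cdot>\<^sub>v cell_vec m i a + 1 \<cdot>\<^sub>v v = v"
    by (intro eq_vecI) (auto simp: cell_vec_def v_def)
  ultimately have "(\<Sum>j\<le>k. p j * 0 ^ j * 1 ^ (k - j)) = 0" using p[of 0 1] low by simp
  moreover have "(\<Sum>j\<le>k. p j * 0 ^ j * 1 ^ (k - j)) = (\<Sum>j\<le>k. if j = 0 then p 0 else 0)"
    by (intro sum.cong) (auto simp: power_0_left)
  ultimately have p0: "p 0 = 0" by simp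
  define r where "r = (\<Sum>j\<in>{1..k}. Polynomial.monom (p j) (k - j))"
  have "Polynomial.degree r \<le> k - 1" unfolding r_def
    by (intro degree_sum_le) (auto intro: order_trans[OF degree_monom_le])
  moreover have "g (cell_vec m i (a + t \<cdot>\<^sub>v b)) = poly r t" for t
  proof -
    have "cell_vec m i (a + t \<cdot>\<^sub>v b) = 1 \<cdot>\<^sub>v cell_vec m i a + t \<cdot>\<^sub>v v"
      using a b i by (intro eq_vecI) (auto simp: cell_vec_def v_def)
    then have "g (cell_vec m i (a + t \<cdot>\<^sub>v b)) = (\<Sum>j\<le>k. p j * t ^ (k - j))" using p[of 1 t] by simp
    also have "\<dots> = (\<Sum>j\<in>{1..k}. p j * t ^ (k - j))"
      using p0 by (intro sum.mono_neutral_right) (auto simp: Suc_le_eq)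
    finally show ?thesis by (simp add: r_def poly_sum poly_monom)
  qed
  ultimately show "\<exists>p. Polynomial.degree p \<le> k - 1 \<and> (\<forall>t. g (cell_vec m i (a + t \<cdot>\<^sub>v b)) = poly p t)" by blast
qed

text \<open>The homogenization to degree k. For h of degree at most k - 1 on lines every term keeps
  a factor x, whence the value 0 at x = 0.\<close>

definition cone :: "nat \<Rightarrow> ('a::field vec \<Rightarrow> 'a) \<Rightarrow> 'a \<Rightarrow> 'a vec \<Rightarrow> 'a" where
  "cone k h x y = (if x = 0 then 0 else x ^ k * h (inverse x \<cdot>\<^sub>v y))"

text \<open>As \<alpha> is nonzero, s can be expressed through x = s * \<alpha> + t * \<beta> and t,
  and y / x runs along a fixed affine line with parameter t / x. Multiplying a polynomial of degree
  below k in t / x by x^k gives a form divisible by x, which is correct at x = 0 as well.\<close>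

lemma hom2_cone:
  assumes h: "lift_aff i (k - 1) h" and k: "k \<ge> 1" and \<alpha>: "\<alpha> \<noteq> 0"
    and a: "a \<in> carrier_vec i" and b: "b \<in> carrier_vec i"
  shows "hom2 k (\<lambda>s t. cone k h (s * \<alpha> + t * \<beta>) (s \<cdot>\<^sub>v a + t \<cdot>\<^sub>v b))"
proof -
  define a' b' where "a' = inverse \<alpha> \<cdot>\<^sub>v a" and "b' = b - (\<beta> / \<alpha>) \<cdot>\<^sub>v a"
  have "a' \<in> carrier_vec i" "b' \<in> carrier_vec i" using a b by (auto simp: a'_def b'_def)
  then obtain p where p: "Polynomial.degree p \<le> k - 1" "\<And>\<tau>. h (a' + \<tau> \<cdot>\<^sub>v b') = poly p \<tau>"
    using h unfolding lift_aff_def by blast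
  have poly_p: "poly p \<tau> = (\<Sum>j<k. Polynomial.coeff p j * \<tau> ^ j)" for \<tau>
  proof -
    have "poly p \<tau> = (\<Sum>j\<le>Polynomial.degree p. Polynomial.coeff p j * \<tau> ^ j)" by (rule poly_altdef)
    also have "\<dots> = (\<Sum>j<k. Polynomial.coeff p j * \<tau> ^ j)"
      using p(1) k by (intro sum.mono_neutral_left) (auto simp: coeff_eq_0 not_le)
    finally show ?thesis .
  qed
  have "cone k h (s * \<alpha> + t * \<beta>) (s \<cdot>\<^sub>v a + t \<cdot>\<^sub>v b) =
      (\<Sum>j<k. Polynomial.coeff p j * ((s * \<alpha> + t * \<beta>) ^ (k - j) * t ^ j))" for s t
  proof (cases "s * \<alpha> + t * \<beta> = 0")
    case True
    then show ?thesis by (simp add: cone_def power_0_left)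
  next
    case False
    define x where "x = s * \<alpha> + t * \<beta>"
    have x: "x \<noteq> 0" using False by (simp add: x_def)
    have s: "s = (x - t * \<beta>) / \<alpha>" using \<alpha> by (simp add: x_def)
    have "inverse x \<cdot>\<^sub>v (s \<cdot>\<^sub>v a + t \<cdot>\<^sub>v b) = a' + (t / x) \<cdot>\<^sub>v b'"
      using a b x \<alpha> by (intro eq_vecI) (auto simp: a'_def b'_def s field_simps)
    then have "cone k h x (s \<cdot>\<^sub>v a + t \<cdot>\<^sub>v b) = x ^ k * (\<Sum>j<k. Polynomial.coeff p j * (t / x) ^ j)"
      using x p(2) poly_p by (simp add: cone_def)
    also have "\<dots> = (\<Sum>j<k. Polynomial.coeff p j * (x ^ (k - j) * t ^ j))"
      unfolding sum_distrib_left
    proof (intro sum.cong refl)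
      fix j assume "j \<in> {..<k}"
      then have "x ^ k = x ^ (k - j) * x ^ j" by (simp flip: power_add)
      then show "x ^ k * (Polynomial.coeff p j * (t / x) ^ j) = Polynomial.coeff p j * (x ^ (k - j) * t ^ j)"
        using x by (simp add: power_divide)
    qed
    finally show ?thesis by (simp add: x_def)
  qed
  moreover have "hom2 k (\<lambda>s t. \<Sum>j<k. Polynomial.coeff p j * ((s * \<alpha> + t * \<beta>) ^ (k - j) * t ^ j))"
  proof (intro hom2_sum hom2_cmult)
    fix j assume j: "j \<in> {..<k}"
    have "hom2 j (\<lambda>s t :: 'a. t ^ j)" using hom2_monom[of 0 j] by simp
    from hom2_mult_linear_power[OF this, of "k - j" \<alpha> \<beta>] j
    show "hom2 k (\<lambda>s t. (s * \<alpha> + t * \<beta>) ^ (k - j) * t ^ j)" by simp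
  qed
  ultimately show ?thesis by simp
qed

text \<open>If a pivot coordinate of u or v is nonzero, \<open>hom2_cone\<close> applies, possibly
  after exchanging s and t. If both are 0, the function is 0 on the plane.\<close>

lemma lift_hom_cone:
  assumes h: "lift_aff i (k - 1) h" and k: "k \<ge> 1" and i: "i \<le> m"
  shows "lift_hom (m + 1) k (\<lambda>u. cone k h (u $ (m - i)) (tail_vec m i u))"
  unfolding lift_hom_def
proof (intro ballI)
  fix u v :: "'a vec" assume u: "u \<in> carrier_vec (m + 1)" and v: "v \<in> carrier_vec (m + 1)"
  define \<alpha> \<beta> a b where "\<alpha> = u $ (m - i)" and "\<beta> = v $ (m - i)"
    and "a = tail_vec m i u" and "b = tail_vec m i v"
  have ab: "a \<in> carrier_vec i" "b \<in> carrier_vec i" by (simp_all add: a_def b_def)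
  have eq: "(\<lambda>s t. cone k h ((s \<cdot>\<^sub>v u + t \<cdot>\<^sub>v v) $ (m - i)) (tail_vec m i (s \<cdot>\<^sub>v u + t \<cdot>\<^sub>v v))) =
     (\<lambda>s t. cone k h (s * \<alpha> + t * \<beta>) (s \<cdot>\<^sub>v a + t \<cdot>\<^sub>v b))"
    using u v i by (simp add: tail_vec_linear a_def b_def \<alpha>_def \<beta>_def)
  show "hom2 k (\<lambda>s t. cone k h ((s \<cdot>\<^sub>v u + t \<cdot>\<^sub>v v) $ (m - i)) (tail_vec m i (s \<cdot>\<^sub>v u + t \<cdot>\<^sub>v v)))"
    unfolding eq
  proof -
    consider "\<alpha> \<noteq> 0" | "\<alpha> = 0" "\<beta> \<noteq> 0" | "\<alpha> = 0" "\<beta> = 0" by blast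
    then show "hom2 k (\<lambda>s t. cone k h (s * \<alpha> + t * \<beta>) (s \<cdot>\<^sub>v a + t \<cdot>\<^sub>v b))"
    proof cases
      case 1
      then show ?thesis using hom2_cone[OF h k _ ab] by blast
    next
      case 2
      have "s \<cdot>\<^sub>v a + t \<cdot>\<^sub>v b = t \<cdot>\<^sub>v b + s \<cdot>\<^sub>v a" for s t
        using ab by (intro comm_add_vec[of _ i]) auto
      then show ?thesis
        using hom2_swap[OF hom2_cone[OF h k 2(2) ab(2,1), of \<alpha>]] by (simp add: add.commute)
    next
      case 3
      then show ?thesis by (simp add: cone_def hom2_zero)
    qed
  qed
qed

text \<open>Gluing needs two properties of \<open>X i\<close>: values there determine a word on cell
  i, and they can be prescribed. Cell 0 is included to treat the single point uniformly.\<close>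

context
  fixes m k :: nat and X :: "nat \<Rightarrow> 'a::{field,finite} vec set"
  assumes m: "m \<ge> 1" and k: "1 \<le> k" "k \<le> CARD('a) - 1"
    and X: "\<And>i. i \<le> m \<Longrightarrow> X i \<subseteq> carrier_vec i"
    and X_zero: "\<And>i h x. i \<le> m \<Longrightarrow> lift_aff i (k - 1) h \<Longrightarrow> (\<And>x. x \<in> X i \<Longrightarrow> h x = 0) \<Longrightarrow>
      x \<in> carrier_vec i \<Longrightarrow> h x = 0"
    and X_interpolate: "\<And>i f. i \<le> m \<Longrightarrow> \<exists>h. lift_aff i (k - 1) h \<and> (\<forall>x\<in>X i. h x = f x)"
begin

text \<open>A new vector at stage \<open>Suc i\<close> is a nonzero multiple of a vector of cell i.
  There g is an affine word by the induction hypothesis, and its zeros on \<open>X i\<close> make it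
  vanish. At i = m + 1 no coordinate is restricted any more.\<close>

lemma lift_hom_zero_if_zero_on_cells:
  assumes g: "lift_hom (m + 1) k g"
    and zero: "\<And>i x. i \<le> m \<Longrightarrow> x \<in> X i \<Longrightarrow> g (cell_vec m i x) = 0"
  shows "i \<le> m + 1 \<Longrightarrow> low_vec m i u \<Longrightarrow> g u = 0"
proof (induction i arbitrary: u)
  case 0
  then have "u = 0\<^sub>v (m + 1)" by (intro eq_vecI) (auto simp: low_vec_def)
  then show ?case using lift_hom_zero[OF g k(1)] by simp
next
  case (Suc i)
  have i: "i \<le> m" using Suc.prems by simp
  have u: "u \<in> carrier_vec (m + 1)" and below: "\<And>j. j < m - i \<Longrightarrow> u $ j = 0"
    using Suc.prems(2) by (auto simp: low_vec_def)
  have lift: "lift_aff i (k - 1) (\<lambda>x. g (cell_vec m i x))"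
    using Suc.IH i by (intro lift_aff_cell[OF g k(1) i]) auto
  define x where "x = u $ (m - i)"
  show ?case
  proof (cases "x = 0")
    case True
    have "u $ j = 0" if "j < m + 1 - i" for j
      using below[of j] that True unfolding x_def by (cases "j = m - i") auto
    then have "low_vec m i u" using u by (simp add: low_vec_def)
    then show ?thesis using Suc.IH i by simp
  next
    case False
    define y where "y = inverse x \<cdot>\<^sub>v tail_vec m i u"
    have y: "y \<in> carrier_vec i" by (simp add: y_def)
    have "u = x \<cdot>\<^sub>v cell_vec m i y"
    proof (rule eq_vecI)
      fix j assume "j < dim_vec (x \<cdot>\<^sub>v cell_vec m i y)"
      then have "j < m + 1" by (simp add: cell_vec_def)
      then show "u $ j = (x \<cdot>\<^sub>v cell_vec m i y) $ j"
        using below[of j] False i by (auto simp: cell_vec_def y_def tail_vec_def x_def)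
    qed (use u in \<open>simp add: cell_vec_def\<close>)
    then have "g u = x ^ k * g (cell_vec m i y)"
      using lift_hom_scale[OF g cell_vec_carrier] by blast
    also have "g (cell_vec m i y) = 0"
      using X_zero[OF i lift _ y] zero[OF i] by blast
    finally show ?thesis by simp
  qed
qed

text \<open>A triangular correction: the cone added for cell n repairs the values there and is 0 on
  smaller cells, whose coordinate of index m - n is 0.\<close>

lemma lift_hom_interpolate_cells:
  "n \<le> m + 1 \<Longrightarrow> \<exists>g. lift_hom (m + 1) k g \<and> (\<forall>i<n. \<forall>x\<in>X i. g (cell_vec m i x) = f i x)"
proof (induction n)
  case 0
  then show ?case using lift_hom_const_zero by auto
next
  case (Suc n)
  then obtain g where g: "lift_hom (m + 1) k g" "\<And>i x. i < n \<Longrightarrow> x \<in> X i \<Longrightarrow> g (cell_vec m i x) = f i x"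
    by auto
  have n: "n \<le> m" using Suc.prems by simp
  obtain h where h: "lift_aff n (k - 1) h" "\<And>x. x \<in> X n \<Longrightarrow> h x = f n x - g (cell_vec m n x)"
    using X_interpolate[OF n, of "\<lambda>x. f n x - g (cell_vec m n x)"] by blast
  let ?e = "\<lambda>u. cone k h (u $ (m - n)) (tail_vec m n u)"
  have "?e (cell_vec m i x) = 0" if "i < n" for i x
    using that n cell_vec_below_pivot[of "m - n" m i x] by (simp add: cone_def)
  moreover have "?e (cell_vec m n x) = h x" if "x \<in> X n" for x
    using that X[OF n] n by (auto simp: cone_def cell_vec_pivot tail_vec_cell_vec subset_iff)
  ultimately have "g (cell_vec m i x) + ?e (cell_vec m i x) = f i x" if "i < Suc n" "x \<in> X i" for i x
    using that g(2) h(2) by (cases "i = n") auto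
  then show ?case
    using lift_hom_add[OF g(1) lift_hom_cone[OF h(1) k(1) n]] by blast
qed

lemma information_set_cells:
  "information_set (proj_space m) (PLift m k) (\<Union>i\<le>m. cell_pt m i ` X i)"
proof -
  define S where "S = (\<Union>i\<le>m. cell_pt m i ` X i)"
  let ?C = "PLift m k :: ('a vec set \<Rightarrow> 'a) set"
  note C = PLift_eq_codewords[OF m k]
  have cw: "codeword m g (cell_pt m i x) = g (cell_vec m i x)" for g :: "'a vec \<Rightarrow> 'a" and i x
    by (simp add: codeword_def cell_pt_eq proj_pt_normalized normalized_cell_vec)
  have "finite (X i)" if "i \<le> m" for i
    using X[OF that] finite_carrier_vec by (rule finite_subset)
  then have finS: "finite S" by (auto simp: S_def)
  have subS: "S \<subseteq> proj_space m"
    by (auto simp: S_def cell_pt_eq proj_pt_normalized normalized_cell_vec)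
  have inj: "inj_on (\<lambda>c. restrict c S) ?C"
  proof (rule inj_onI)
    fix c c' assume "c \<in> ?C" "c' \<in> ?C" and eq: "restrict c S = restrict c' S"
    then obtain g g' where g: "lift_hom (m + 1) k g" "lift_hom (m + 1) k g'"
      "c = codeword m g" "c' = codeword m g'"
      unfolding C by blast
    let ?d = "\<lambda>x. g x + (-1) * g' x"
    have d: "lift_hom (m + 1) k ?d"
      using lift_hom_add[OF g(1) lift_hom_cmult[OF g(2), of "-1"]] .
    have "?d (cell_vec m i x) = 0" if "i \<le> m" "x \<in> X i" for i x
    proof -
      have "cell_pt m i x \<in> S" using that by (auto simp: S_def)
      then have "c (cell_pt m i x) = c' (cell_pt m i x)" using eq by (metis restrict_apply')
      then show ?thesis by (simp add: g(3,4) cw)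
    qed
    from lift_hom_zero_if_zero_on_cells[OF d this, of "m + 1"]
    have "?d u = 0" if "u \<in> carrier_vec (m + 1)" for u
      using that by (simp add: low_vec_def)
    then have "g u = g' u" if "normalized m u" for u
      using that by (simp add: normalized_def)
    then show "c = c'" unfolding g(3,4) codeword_eq_iff by blast
  qed
  have surj: "(\<lambda>c. restrict c S) ` ?C = S \<rightarrow>\<^sub>E UNIV"
  proof (intro equalityI subsetI)
    fix f :: "'a vec set \<Rightarrow> 'a" assume f: "f \<in> S \<rightarrow>\<^sub>E UNIV"
    obtain g where g: "lift_hom (m + 1) k g"
      "\<And>i x. i < m + 1 \<Longrightarrow> x \<in> X i \<Longrightarrow> g (cell_vec m i x) = f (cell_pt m i x)"
      using lift_hom_interpolate_cells[OF order_refl, of "\<lambda>i x. f (cell_pt m i x)"] by blast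
    have "codeword m g P = f P" if "P \<in> S" for P
      using that g(2) by (auto simp: S_def cw)
    then have "restrict (codeword m g) S = f"
      using f by (intro PiE_ext[of _ S "\<lambda>_. UNIV"]) auto
    then show "f \<in> (\<lambda>c. restrict c S) ` ?C" unfolding C using g(1) by blast
  qed auto
  \<comment> \<open>Counting needs a finite code; it embeds into the finitely many functions on
    \<open>S\<close>.\<close>
  have finC: "finite ?C"
    by (rule finite_imageD[OF _ inj]) (simp add: surj finite_PiE finS)
  have sub: "code.subspace ?C"
  proof (rule code.subspaceI)
    have "(0 :: 'a vec set \<Rightarrow> 'a) = codeword m (\<lambda>_. 0)" by (auto simp: codeword_def)
    then show "0 \<in> ?C" unfolding C using lift_hom_const_zero by blast
  next
    fix x y assume "x \<in> ?C" "y \<in> ?C"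
    then obtain g h where gh: "lift_hom (m + 1) k g" "lift_hom (m + 1) k h" "x = codeword m g" "y = codeword m h"
      unfolding C by blast
    have "x + y = codeword m (\<lambda>z. g z + h z)" unfolding gh by (auto simp: codeword_def)
    then show "x + y \<in> ?C" unfolding C using lift_hom_add[OF gh(1,2)] by blast
  next
    fix c x assume "x \<in> ?C"
    then obtain g where g: "lift_hom (m + 1) k g" "x = codeword m g"
      unfolding C by blast
    have "fun_scale c x = codeword m (\<lambda>z. c * g z)" unfolding g by (auto simp: codeword_def fun_scale_def)
    then show "fun_scale c x \<in> ?C" unfolding C using lift_hom_cmult[OF g(1)] by blast
  qed
  \<comment> \<open>The restriction to \<open>S\<close> is a bijection onto all functions on
    \<open>S\<close>, so comparing cardinalities yields the dimension.\<close>
  have "CARD('a) ^ code.dim ?C = CARD('a) ^ card S"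
    using card_subspace[OF sub finC] card_image[OF inj] finS unfolding surj by (simp add: card_PiE)
  then have "card S = code.dim ?C"
    using finite_field_card_gt_1[where 'a = 'a] by (simp add: power_inject_exp)
  then show ?thesis
    unfolding information_set_def S_def[symmetric] using subS finS inj by blast
qed

end

theorem theorem55:
  fixes m k :: nat
    and K :: "nat \<Rightarrow> 'b ring"
    and e :: "nat \<Rightarrow> 'a::{field,finite} \<Rightarrow> 'b"
    and \<omega> :: "nat \<Rightarrow> 'b"
    and \<phi> :: "nat \<Rightarrow> 'b \<Rightarrow> 'a vec set"
  assumes "m \<ge> 1"
    and "1 \<le> k" and "k \<le> CARD('a) - 1"
    and "\<And>i. i \<in> {1..m} \<Longrightarrow> ext_field i (K i) (e i)"
    and "\<And>i. i \<in> {1..m} \<Longrightarrow> primitive_element (K i) (\<omega> i)"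
    and "\<And>i. i \<in> {1..m} \<Longrightarrow> cell_iso m i (K i) (e i) (\<phi> i)"
  shows "let P0 = proj_pt m (unit_vec (m + 1) m);
             B = (\<lambda>i. (\<lambda>n::nat. \<phi> i (\<omega> i [^]\<^bsub>K i\<^esub> n)) `
                   {1..code.dim (Lift i (k - 1) :: ('a vec \<Rightarrow> 'a) set)})
         in P0 \<notin> (\<Union>i\<in>{1..m}. B i) \<and> disjoint_family_on B {1..m} \<and>
            information_set (proj_space m) (PLift m k :: ('a vec set \<Rightarrow> 'a) set)
              ({P0} \<union> (\<Union>i\<in>{1..m}. B i))"
proof -
  define P0 where "P0 = proj_pt m (unit_vec (m + 1) m :: 'a vec)"
  define B where "B i = (\<lambda>n::nat. \<phi> i (\<omega> i [^]\<^bsub>K i\<^esub> n)) `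
      {1..code.dim (Lift i (k - 1) :: ('a vec \<Rightarrow> 'a) set)}" for i
  have "\<forall>i\<in>{1..m}. \<exists>\<psi>. linear_iso i (K i) (e i) \<psi> \<and> (\<forall>x\<in>carrier (K i). \<phi> i x = cell_pt m i (\<psi> x))"
    using assms(6) unfolding cell_iso_def by blast
  then obtain \<psi> where \<psi>: "\<And>i. i \<in> {1..m} \<Longrightarrow> linear_iso i (K i) (e i) (\<psi> i)"
    and \<phi>: "\<And>i x. i \<in> {1..m} \<Longrightarrow> x \<in> carrier (K i) \<Longrightarrow> \<phi> i x = cell_pt m i (\<psi> i x)"
    by metis
  \<comment> \<open>The point \<open>P0\<close> is cell 0 with the empty vector as its only
    coordinate vector, so it becomes the case i = 0. Every function on that cell is constant, so it
    is determined and prescribed by one value.\<close>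
  define X where "X i = (if i = 0 then {0\<^sub>v 0} else (\<lambda>n::nat. \<psi> i (\<omega> i [^]\<^bsub>K i\<^esub> n)) `
      {1..code.dim (Lift i (k - 1) :: ('a vec \<Rightarrow> 'a) set)})" for i
  have d: "k - 1 < CARD('a) - 1" using assms(2,3) by linarith
  have carrier0: "x = 0\<^sub>v 0" if "x \<in> carrier_vec 0" for x :: "'a vec"
    using that by (intro eq_vecI) auto
  have B_X: "B i = cell_pt m i ` X i" if i: "i \<in> {1..m}" for i
  proof -
    interpret field "K i" using assms(4)[OF i] by (simp add: ext_field_def)
    have "\<omega> i \<in> carrier (K i)" using assms(5)[OF i] by (simp add: primitive_element_def)
    then have "\<phi> i (\<omega> i [^]\<^bsub>K i\<^esub> n) = cell_pt m i (\<psi> i (\<omega> i [^]\<^bsub>K i\<^esub> n))" for n :: nat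
      by (intro \<phi>[OF i] nat_pow_closed)
    then show ?thesis using i by (simp add: B_def X_def image_image)
  qed
  have "cell_vec m 0 (0\<^sub>v 0) = (unit_vec (m + 1) m :: 'a vec)"
    by (intro eq_vecI) (auto simp: cell_vec_def)
  then have P0: "P0 = cell_pt m 0 (0\<^sub>v 0)" by (simp add: P0_def cell_pt_eq)
  then have P0_X: "{P0} = cell_pt m 0 ` X 0" by (simp add: X_def)
  have "(\<Union>i\<le>m. cell_pt m i ` X i) = cell_pt m 0 ` X 0 \<union> (\<Union>i\<in>{1..m}. cell_pt m i ` X i)"
  proof -
    have "{..m} = insert 0 {1..m}" by auto
    then show ?thesis by simp
  qed
  then have S: "{P0} \<union> (\<Union>i\<in>{1..m}. B i) = (\<Union>i\<le>m. cell_pt m i ` X i)"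
    using P0_X B_X by simp
  have "information_set (proj_space m) (PLift m k) (\<Union>i\<le>m. cell_pt m i ` X i)"
  proof (rule information_set_cells[OF assms(1-3)])
    fix i assume i: "i \<le> m"
    show "X i \<subseteq> carrier_vec i"
    proof (cases "i = 0")
      case False
      then have i': "i \<in> {1..m}" "i \<ge> 1" using i by auto
      show ?thesis
        using linear_iso_interpolate_powers(1)[OF assms(4,5)[OF i'(1)] \<psi>[OF i'(1)] i'(2) d] False
        by (simp add: X_def)
    qed (simp add: X_def)
    fix h :: "'a vec \<Rightarrow> 'a" and x :: "'a vec"
    assume h: "lift_aff i (k - 1) h" "\<And>x. x \<in> X i \<Longrightarrow> h x = 0" and x: "x \<in> carrier_vec i"
    show "h x = 0"
    proof (cases "i = 0")
      case True
      then show ?thesis using h(2)[of "0\<^sub>v 0"] carrier0 x by (simp add: X_def)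
    next
      case False
      then have i': "i \<in> {1..m}" "i \<ge> 1" using i by auto
      show ?thesis
        by (rule linear_iso_zero_on_powers[OF assms(4,5)[OF i'(1)] \<psi>[OF i'(1)] i'(2) d h(1) _ x])
          (use False in \<open>auto simp: X_def intro!: h(2)\<close>)
    qed
  next
    fix i and f :: "'a vec \<Rightarrow> 'a" assume i: "i \<le> m"
    show "\<exists>h. lift_aff i (k - 1) h \<and> (\<forall>x\<in>X i. h x = f x)"
    proof (cases "i = 0")
      case True
      then show ?thesis using lift_aff_const[of i "k - 1" "f (0\<^sub>v 0)"] by (auto simp: X_def)
    next
      case False
      then have i': "i \<in> {1..m}" "i \<ge> 1" using i by auto
      show ?thesis
        using linear_iso_interpolate_powers(2)[OF assms(4,5)[OF i'(1)] \<psi>[OF i'(1)] i'(2) d, of f] False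
        by (simp add: X_def)
    qed
  qed
  moreover have "P0 \<notin> (\<Union>i\<in>{1..m}. B i)"
  proof
    assume "P0 \<in> (\<Union>i\<in>{1..m}. B i)"
    then obtain i where i: "i \<in> {1..m}" and "P0 \<in> B i" by (rule UN_E)
    then have "P0 \<in> cell_pt m i ` X i" using B_X by simp
    then obtain y where "P0 = cell_pt m i y" by (rule imageE)
    then have "cell_pt m 0 (0\<^sub>v 0) = cell_pt m i y" unfolding P0 .
    from cell_pt_inj[OF this] i have "0 = i" by simp
    then show False using i by simp
  qed
  moreover have "disjoint_family_on B {1..m}"
    unfolding disjoint_family_on_def
  proof (intro ballI impI)
    fix i l assume il: "i \<in> {1..m}" "l \<in> {1..m}" "i \<noteq> l"
    then show "B i \<inter> B l = {}" using cell_pt_inj[of m i _ l] by (auto simp: B_X)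
  qed
  ultimately show ?thesis unfolding Let_def S[symmetric] P0_def B_def by blast
qed

end
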